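(* Let $K$ be a field of characteristic $p>0$ and $s\ge1$. For $u=(u_{ik})\in\mathcal{M}_{n,s}$ define elements of $\mathcal{D}_n$: $y_{u,i}^{[0]}=1$, $y_{u,i}^{[1]}=\partial_i^{[p^s]}+u_{i0}$, recursively for $k\ge1$ $y_{u,i}^{[p^k]}=u_{ik}+\int_i^{*p^s}\prod_{l=0}^{k-1}\frac{(y_{u,i}^{[p^l]})^{p-1}}{(p-1)!}$, for $j=\sum_kj_kp^k$ ($0\le j_k<p$) $y_{u,i}^{[j]}=\prod_k\frac{(y_{u,i}^{[p^k]})^{j_k}}{j_k!}$, and $y_u^{[\alpha]}=\prod_{i=1}^ny_{u,i}^{[\alpha_i]}$ for $\alpha\in\mathbb{N}^n$. Then the map $u\mapsto y_u=\{y_u^{[\alpha]}\}_{\alpha\in\mathbb{N}^n}$ is a bijection from $\mathcal{M}_{n,s}$ onto the set $\mathrm{ID}(\delta^{p^s},\mathcal{D}_n)$, and its inverse sends $z=\{z^{[\alpha]}\}$ to $u=(u_{ik})$ with $u_{ik}=z_i^{[p^k]}-\int_i^{*p^s}z_i^{[p^k-1]}$, where $z_i^{[j]}:=z^{[je_i]}$.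
   Context: $P_n=K[x_1,\ldots,x_n]$; $\partial_i^{[k]}=\partial_i^k/k!$, $\partial^{[\alpha]}=\prod_i\partial_i^{[\alpha_i]}$; $\mathcal{D}_n=\bigoplus_{\alpha\in\mathbb{N}^n}K\partial^{[\alpha]}$ is the commutative algebra of scalar differential operators, with $\partial^{[\alpha]}\partial^{[\beta]}=\binom{\alpha+\beta}{\beta}\partial^{[\alpha+\beta]}$. Let $\delta_i=-\mathrm{ad}(x_i)$ (inner derivation of the ring of differential operators $\mathcal{D}(P_n)$); on $\mathcal{D}_n$, $\delta_i(\partial^{[\alpha]})=\partial^{[\alpha-e_i]}$ (zero if $\alpha_i=0$), so $\delta_i^{p^s}$ maps $\mathcal{D}_n$ to itself; $\delta^{p^s}=(\delta_1^{p^s},\ldots,\delta_n^{p^s})$. $\mathrm{ID}(\delta^{p^s},\mathcal{D}_n)$ is the set of families $\{y^{[\alpha]}\}_{\alpha\in\mathbb{N}^n}\subseteq\mathcal{D}_n$ with $y^{[0]}=1$, $y^{[\alpha]}y^{[\beta]}=\binom{\alpha+\beta}{\beta}y^{[\alpha+\beta]}$ and $\prod_i(\delta_i^{p^s})^{\alpha_i}(y^{[\beta]})=y^{[\beta-\alpha]}$ for all $\alpha,\beta$ ($y^{[\gamma]}=0$ if $\gamma\notin\mathbb{N}^n$). The dual integration $\int_i^*:\mathcal{D}_n\to\mathcal{D}_n$ is the $K$-linear map $\partial^{[\alpha]}\mapsto\partial^{[\alpha+e_i]}$, and $\int_i^{*p^s}$ is its $p^s$-th power. $C_s^n=\{\alpha\in\mathbb{N}^n\mid\alpha_i<p^s\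 \forall i\}$. $\mathcal{M}_{n,s}$ is the set of matrices $u=(u_{ik})$, $i=1,\ldots,n$, $k\in\mathbb{N}$, with all $u_{ik}\in\bigoplus_{0\neq\alpha\in C_s^n}K\partial^{[\alpha]}$. *)

theory Defs
  imports Main
begin

text \<open>Multi-indices in N^n are functions nat => nat vanishing at indices >= n
  (coordinates are numbered 0..n-1 instead of 1..n).
  An element of D_n is represented by its coefficient function
  alpha |-> coefficient of the basis element d^[alpha].\<close>

type_synonym 'a dop = "(nat \<Rightarrow> nat) \<Rightarrow> 'a"

definition mi :: "nat \<Rightarrow> (nat \<Rightarrow> nat) \<Rightarrow> bool" where
  "mi n \<alpha> \<longleftrightarrow> (\<forall>i\<ge>n. \<alpha> i = 0)"

definition zero_mi :: "nat \<Rightarrow> nat" where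
  "zero_mi = (\<lambda>_. 0)"

text \<open>j e_i\<close>
definition unit_mi :: "nat \<Rightarrow> nat \<Rightarrow> (nat \<Rightarrow> nat)" where
  "unit_mi i j = (\<lambda>l. if l = i then j else 0)"

text \<open>The carrier D_n: finite linear combinations of d^[alpha], alpha in N^n.\<close>
definition Dn :: "nat \<Rightarrow> 'a::field dop set" where
  "Dn n = {f. finite {\<alpha>. f \<alpha> \<noteq> 0} \<and> (\<forall>\<alpha>. f \<alpha> \<noteq> 0 \<longrightarrow> mi n \<alpha>)}"

text \<open>Basis element d^[alpha].\<close>
definition dpb :: "(nat \<Rightarrow> nat) \<Rightarrow> 'a::field dop" where
  "dpb \<alpha> = (\<lambda>\<beta>. if \<beta> = \<alpha> then 1 else 0)"

definition dunit :: "'a::field dop" where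
  "dunit = dpb zero_mi"

definition dzero :: "'a::field dop" where
  "dzero = (\<lambda>_. 0)"

definition dadd :: "'a::field dop \<Rightarrow> 'a dop \<Rightarrow> 'a dop" where
  "dadd f g = (\<lambda>\<alpha>. f \<alpha> + g \<alpha>)"

definition dsub :: "'a::field dop \<Rightarrow> 'a dop \<Rightarrow> 'a dop" where
  "dsub f g = (\<lambda>\<alpha>. f \<alpha> - g \<alpha>)"

definition dscale :: "'a::field \<Rightarrow> 'a dop \<Rightarrow> 'a dop" where
  "dscale c f = (\<lambda>\<alpha>. c * f \<alpha>)"

text \<open>Multi-binomial coefficient binom(gamma, beta) = prod_i binom(gamma_i, beta_i).\<close>
definition mbinom :: "nat \<Rightarrow> (nat \<Rightarrow> nat) \<Rightarrow> (nat \<Rightarrow> nat) \<Rightarrow> nat" where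
  "mbinom n \<gamma> \<beta> = (\<Prod>i<n. \<gamma> i choose \<beta> i)"

text \<open>Multiplication of D_n, the bilinear extension of
  d^[alpha] d^[beta] = binom(alpha+beta, beta) d^[alpha+beta].\<close>
definition dmul :: "nat \<Rightarrow> 'a::field dop \<Rightarrow> 'a dop \<Rightarrow> 'a dop" where
  "dmul n f g = (\<lambda>\<gamma>. \<Sum>\<beta>\<in>{\<beta>. \<forall>i. \<beta> i \<le> \<gamma> i}.
      of_nat (mbinom n \<gamma> \<beta>) * f (\<lambda>i. \<gamma> i - \<beta> i) * g \<beta>)"

definition dpow :: "nat \<Rightarrow> 'a::field dop \<Rightarrow> nat \<Rightarrow> 'a dop" where
  "dpow n f k = (dmul n f ^^ k) dunit"

definition dprod_list :: "nat \<Rightarrow> 'a::field dop list \<Rightarrow> 'a dop" where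
  "dprod_list n xs = foldr (dmul n) xs dunit"

text \<open>delta_i = -ad(x_i) on D_n: d^[alpha] |-> d^[alpha - e_i] (0 if alpha_i = 0).\<close>
definition delta :: "nat \<Rightarrow> 'a::field dop \<Rightarrow> 'a dop" where
  "delta i f = (\<lambda>\<beta>. f (\<beta>(i := Suc (\<beta> i))))"

text \<open>Dual integration: d^[alpha] |-> d^[alpha + e_i].\<close>
definition dint :: "nat \<Rightarrow> 'a::field dop \<Rightarrow> 'a dop" where
  "dint i f = (\<lambda>\<beta>. if \<beta> i = 0 then 0 else f (\<beta>(i := \<beta> i - 1)))"

text \<open>prod_{i<m} (delta_i^{p^s})^{alpha_i}\<close>
fun deltas :: "nat \<Rightarrow> nat \<Rightarrow> nat \<Rightarrow> (nat \<Rightarrow> nat) \<Rightarrow> 'a::field dop \<Rightarrow> 'a dop" where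
  "deltas p s 0 \<alpha> f = f"
| "deltas p s (Suc m) \<alpha> f = ((delta m ^^ (p ^ s)) ^^ \<alpha> m) (deltas p s m \<alpha> f)"

text \<open>ID(delta^{p^s}, D_n); families are indexed by all functions nat => nat,
  and are required to vanish at indices that are not in N^n (extensional convention).\<close>
definition ID :: "nat \<Rightarrow> nat \<Rightarrow> nat \<Rightarrow> ((nat \<Rightarrow> nat) \<Rightarrow> 'a::field dop) set" where
  "ID n p s = {z.
     (\<forall>\<alpha>. mi n \<alpha> \<longrightarrow> z \<alpha> \<in> Dn n) \<and>
     (\<forall>\<alpha>. \<not> mi n \<alpha> \<longrightarrow> z \<alpha> = dzero) \<and>
     z zero_mi = dunit \<and>
     (\<forall>\<alpha> \<beta>. mi n \<alpha> \<longrightarrow> mi n \<beta> \<longrightarrow>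
        dmul n (z \<alpha>) (z \<beta>) = dscale (of_nat (mbinom n (\<lambda>i. \<alpha> i + \<beta> i) \<beta>)) (z (\<lambda>i. \<alpha> i + \<beta> i))) \<and>
     (\<forall>\<alpha> \<beta>. mi n \<alpha> \<longrightarrow> mi n \<beta> \<longrightarrow>
        deltas p s n \<alpha> (z \<beta>) = (if \<forall>i. \<alpha> i \<le> \<beta> i then z (\<lambda>i. \<beta> i - \<alpha> i) else dzero))}"

text \<open>C_s^n\<close>
definition Csn :: "nat \<Rightarrow> nat \<Rightarrow> nat \<Rightarrow> (nat \<Rightarrow> nat) set" where
  "Csn n p s = {\<alpha>. mi n \<alpha> \<and> (\<forall>i. \<alpha> i < p ^ s)}"

text \<open>M_{n,s}: matrices u i k (rows i < n, k in N) with entries in the span of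
  d^[alpha], 0 ~= alpha in C_s^n; rows i >= n are required to be 0 (extensional).\<close>
definition Mns :: "nat \<Rightarrow> nat \<Rightarrow> nat \<Rightarrow> (nat \<Rightarrow> nat \<Rightarrow> 'a::field dop) set" where
  "Mns n p s = {u. (\<forall>i k. i < n \<longrightarrow>
       (\<forall>\<alpha>. u i k \<alpha> \<noteq> 0 \<longrightarrow> \<alpha> \<in> Csn n p s \<and> \<alpha> \<noteq> zero_mi)) \<and>
     (\<forall>i k. n \<le> i \<longrightarrow> u i k = dzero)}"

text \<open>The list [y_{u,i}^[p^0], ..., y_{u,i}^[p^k]].\<close>
primrec ypl :: "nat \<Rightarrow> nat \<Rightarrow> nat \<Rightarrow> (nat \<Rightarrow> nat \<Rightarrow> 'a::field dop) \<Rightarrow> nat \<Rightarrow> nat \<Rightarrow> 'a dop list" where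
  "ypl n p s u i 0 = [dadd (dpb (unit_mi i (p ^ s))) (u i 0)]"
| "ypl n p s u i (Suc k) = ypl n p s u i k @
     [dadd (u i (Suc k))
        ((dint i ^^ (p ^ s))
           (dprod_list n (map (\<lambda>y. dscale (inverse (of_nat (fact (p - 1)))) (dpow n y (p - 1)))
                             (ypl n p s u i k))))]"

text \<open>y_{u,i}^[p^k]\<close>
definition ypk :: "nat \<Rightarrow> nat \<Rightarrow> nat \<Rightarrow> (nat \<Rightarrow> nat \<Rightarrow> 'a::field dop) \<Rightarrow> nat \<Rightarrow> nat \<Rightarrow> 'a dop" where
  "ypk n p s u i k = ypl n p s u i k ! k"

text \<open>y_{u,i}^[j] = prod_k (y_{u,i}^[p^k])^{j_k} / j_k!, j_k the base-p digits of j
  (digits at positions k > j vanish, so the product over k <= j suffices).\<close>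
definition yij :: "nat \<Rightarrow> nat \<Rightarrow> nat \<Rightarrow> (nat \<Rightarrow> nat \<Rightarrow> 'a::field dop) \<Rightarrow> nat \<Rightarrow> nat \<Rightarrow> 'a dop" where
  "yij n p s u i j = (if j = 0 then dunit else
     dprod_list n (map (\<lambda>k. let jk = (j div p ^ k) mod p in
        dscale (inverse (of_nat (fact jk))) (dpow n (ypk n p s u i k) jk)) [0..<Suc j]))"

text \<open>y_u^[alpha] = prod_{i<n} y_{u,i}^[alpha_i] (0 outside N^n).\<close>
definition yfam :: "nat \<Rightarrow> nat \<Rightarrow> nat \<Rightarrow> (nat \<Rightarrow> nat \<Rightarrow> 'a::field dop) \<Rightarrow> (nat \<Rightarrow> nat) \<Rightarrow> 'a dop" where
  "yfam n p s u \<alpha> = (if mi n \<alpha> then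
     dprod_list n (map (\<lambda>i. yij n p s u i (\<alpha> i)) [0..<n]) else dzero)"

text \<open>The claimed inverse: u_{ik} = z_i^[p^k] - int_i^{*p^s} z_i^[p^k - 1].\<close>
definition uinv :: "nat \<Rightarrow> nat \<Rightarrow> nat \<Rightarrow> ((nat \<Rightarrow> nat) \<Rightarrow> 'a::field dop) \<Rightarrow> nat \<Rightarrow> nat \<Rightarrow> 'a dop" where
  "uinv n p s z i k = (if i < n then
     dsub (z (unit_mi i (p ^ k))) ((dint i ^^ (p ^ s)) (z (unit_mi i (p ^ k - 1))))
   else dzero)"

end

theory Submission
  imports Defs "HOL-Computational_Algebra.Primes" "HOL-Library.Function_Algebras"
begin

text \<open>
  In characteristic \<open>p\<close> the power \<open>\<delta>\<^sub>i\<^bsup>p^s\<^esup>\<close> is again a derivation, with right inverse \<open>\<integral>\<^sub>i\<^bsup>*p^s\<^esup>\<close>.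
  By Lucas' theorem a sequence of divided powers \<open>z\<^bsup>[j]\<^esup>\<close> is the same thing as its subsequence
  \<open>z\<^bsup>[p^k]\<^esup>\<close>, whose members have vanishing \<open>p\<close>-th power: \<open>z\<^bsup>[j]\<^esup>\<close> is the product of the
  \<open>(z\<^bsup>[p^k]\<^esup>)\<^bsup>j_k\<^esup> / j_k!\<close> over the base-\<open>p\<close> digits of \<open>j\<close>. An operator \<open>f\<close> satisfies \<open>f\<^bsup>p\<^esup> = 0\<close> iff
  its constant term is \<open>0\<close>, because all \<open>\<delta>\<^sub>i\<close> kill \<open>f\<^bsup>p\<^esup>\<close>. Finally
  \<open>\<delta>\<^sub>i\<^bsup>p^s\<^esup> z\<^bsup>[p^k]\<^esup> = z\<^bsup>[p^k - 1]\<^esup>\<close> determines \<open>z\<^bsup>[p^k]\<^esup>\<close> from the earlier members up to an element of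
  the common kernel of all \<open>\<delta>\<^sub>l\<^bsup>p^s\<^esup>\<close>, the span of the \<open>\<partial>\<^bsup>[\<alpha>]\<^esup>\<close> with \<open>\<alpha> \<in> C\<^sub>s\<^sup>n\<close>;
  this element is \<open>u\<^sub>i\<^sub>k\<close>, and it is arbitrary except that its constant term is \<open>0\<close>.
\<close>

section \<open>Divided powers in characteristic p\<close>

definition divided_powers :: "(nat \<Rightarrow> 'b::comm_ring_1) \<Rightarrow> bool" where
  "divided_powers z \<longleftrightarrow> z 0 = 1 \<and> (\<forall>a b. z a * z b = of_nat ((a + b) choose b) * z (a + b))"

section \<open>Derivations of a commutative ring and the higher Leibniz rule\<close>

definition derivation :: "('b::comm_ring_1 \<Rightarrow> 'b) \<Rightarrow> bool" where
  "derivation d \<longleftrightarrow> (\<forall>x y. d (x + y) = d x + d y) \<and> (\<forall>x y. d (x * y) = d x * y + x * d y)"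

lemma derivation_add: "derivation d \<Longrightarrow> d (x + y) = d x + d y"
  by (simp add: derivation_def)

lemma derivation_mult: "derivation d \<Longrightarrow> d (x * y) = d x * y + x * d y"
  by (simp add: derivation_def)

lemma derivation_0: "derivation d \<Longrightarrow> d 0 = 0"
  using derivation_add[of d 0 0] by simp

lemma derivation_1: "derivation d \<Longrightarrow> d 1 = 0"
  using derivation_mult[of d 1 1] by simp

lemma derivation_of_nat: "derivation d \<Longrightarrow> d (of_nat k) = 0"
  by (induction k) (simp_all add: derivation_0 derivation_1 derivation_add)

lemma derivation_power: "derivation d \<Longrightarrow> d (x ^ k) = of_nat k * x ^ (k - 1) * d x"
proof (induction k)
  case (Suc k)
  then show ?case
    by (cases k) (simp_all add: derivation_1 derivation_mult algebra_simps)
qed (simp add: derivation_1)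

lemma derivation_sum: "derivation d \<Longrightarrow> d (sum f A) = (\<Sum>x\<in>A. d (f x))"
  by (induction A rule: infinite_finite_induct) (simp_all add: derivation_0 derivation_add)

lemma derivation_prod_eq_0:
  "derivation d \<Longrightarrow> (\<And>x. x \<in> A \<Longrightarrow> d (f x) = 0) \<Longrightarrow> d (prod f A) = 0"
  by (induction A rule: infinite_finite_induct) (simp_all add: derivation_1 derivation_mult)

lemma derivation_funpow_add: "derivation d \<Longrightarrow> (d ^^ m) (x + y) = (d ^^ m) x + (d ^^ m) y"
  by (induction m) (simp_all add: derivation_add)

lemma derivation_leibniz:
  assumes d: "derivation d"
  shows "(d ^^ m) (x * y) = (\<Sum>k\<le>m. of_nat (m choose k) * (d ^^ k) x * (d ^^ (m - k)) y)"
proof (induction m)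
  case (Suc m)
  have "(d ^^ Suc m) (x * y)
      = (\<Sum>k\<le>m. of_nat (m choose k) * ((d ^^ Suc k) x * (d ^^ (m - k)) y + (d ^^ k) x * (d ^^ (Suc m - k)) y))"
    by (simp add: Suc.IH derivation_sum[OF d] derivation_mult[OF d] derivation_of_nat[OF d]
        mult.assoc Suc_diff_le)
  also have "\<dots> = (\<Sum>k\<le>m. of_nat (m choose k) * ((d ^^ Suc k) x * (d ^^ (m - k)) y))
      + (\<Sum>k\<le>m. of_nat (m choose k) * ((d ^^ k) x * (d ^^ (Suc m - k)) y))"
    by (simp add: distrib_left sum.distrib)
  \<comment> \<open>The added term k = \<open>Suc m\<close> has binomial 0. With it, splitting off k
    = 0 leaves a sum that combines with the first one by Pascal's rule.\<close>
  also have "(\<Sum>k\<le>m. of_nat (m choose k) * ((d ^^ k) x * (d ^^ (Suc m - k)) y))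
      = (\<Sum>k\<le>Suc m. of_nat (m choose k) * ((d ^^ k) x * (d ^^ (Suc m - k)) y))"
    by (simp add: binomial_eq_0)
  also have "\<dots> = x * (d ^^ Suc m) y
      + (\<Sum>k\<le>m. of_nat (m choose Suc k) * ((d ^^ Suc k) x * (d ^^ (m - k)) y))"
    by (subst sum.atMost_Suc_shift) simp
  also have "(\<Sum>k\<le>m. of_nat (m choose k) * ((d ^^ Suc k) x * (d ^^ (m - k)) y)) + (x * (d ^^ Suc m) y
      + (\<Sum>k\<le>m. of_nat (m choose Suc k) * ((d ^^ Suc k) x * (d ^^ (m - k)) y)))
      = x * (d ^^ Suc m) y
      + (\<Sum>k\<le>m. of_nat (Suc m choose Suc k) * ((d ^^ Suc k) x * (d ^^ (m - k)) y))"
    by (simp add: sum.distrib distrib_right del: funpow.simps)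
  also have "\<dots> = (\<Sum>k\<le>Suc m. of_nat (Suc m choose k) * (d ^^ k) x * (d ^^ (Suc m - k)) y)"
    by (subst sum.atMost_Suc_shift) (simp add: mult.assoc)
  finally show ?case .
qed simp

text \<open>The ring of operators has no division operation, so the inverses of the units j! with j
  < p enter as a function \<open>ifact\<close>.\<close>

locale char_p_ring =
  fixes p :: nat and ifact :: "nat \<Rightarrow> 'b::comm_ring_1"
  assumes prime_p: "prime p"
    and of_nat_p: "of_nat p = (0::'b)"
    and fact_ifact: "j < p \<Longrightarrow> of_nat (fact j) * ifact j = 1"
begin

lemma p_gt_1: "1 < p"
  using prime_p by (rule prime_gt_1_nat)

lemma of_nat_eq_0_if_dvd: "p dvd m \<Longrightarrow> of_nat m = (0::'b)"
  by (auto simp: of_nat_p)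

lemma ifact_0 [simp]: "ifact 0 = 1"
  using fact_ifact[of 0] p_gt_1 by simp

lemma ifact_cancel:
  fixes x y :: 'b
  assumes "j < p" "of_nat (fact j) * x = of_nat (fact j) * y"
  shows "x = y"
proof -
  have "ifact j * (of_nat (fact j) * x) = ifact j * (of_nat (fact j) * y)"
    using assms(2) by simp
  then show ?thesis
    using fact_ifact[OF assms(1)] by (metis mult.assoc mult.commute mult_1)
qed

text \<open>Lucas' theorem for the lowest digit, as an identity in the ring. Pascal's rule drives
  the induction on m; the cases are whether the lowest digits of m and of k' wrap from p - 1 to
  0.\<close>

lemma of_nat_binomial_lucas:
  "(of_nat (m choose k) :: 'b)
     = of_nat ((m mod p) choose (k mod p)) * of_nat ((m div p) choose (k div p))"
proof (induction m arbitrary: k)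
  case 0
  show ?case
  proof (cases "k = 0")
    case False
    then have "k mod p \<noteq> 0 \<or> k div p \<noteq> 0"
      by (metis mod_mult_div_eq add_0 mult_0_right)
    with False show ?thesis by (auto simp: binomial_eq_0)
  qed simp
next
  case (Suc m)
  show ?case
  proof (cases k)
    case (Suc k')
    have 1: "m mod p < p" "k' mod p < p"
      using p_gt_1 by auto
    \<comment> \<open>If m wraps and k' does not, the low-digit binomial on the right is 0 choose a
      positive number, so the two summands on the left must cancel: they add up to a multiple of p
      choose \<open>Suc j\<close>.\<close>
    have carry: "of_nat ((p - Suc 0) choose j) + of_nat ((p - Suc 0) choose Suc j) = (0::'b)"
      if "Suc j < p" for j
    proof -
      have "((p - Suc 0) choose j) + ((p - Suc 0) choose Suc j) = p choose Suc j"
        using p_gt_1 by (cases p) auto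
      moreover have "p dvd (p choose Suc j)"
        using that prime_p by (intro dvd_choose_prime) auto
      ultimately show ?thesis
        using of_nat_eq_0_if_dvd by (metis of_nat_add)
    qed
    have "(of_nat (Suc m choose Suc k') :: 'b) = of_nat (m choose k') + of_nat (m choose Suc k')"
      by simp
    also have "\<dots> = of_nat ((Suc m mod p) choose (Suc k' mod p)) * of_nat ((Suc m div p) choose (Suc k' div p))"
    proof (cases "Suc (m mod p) = p")
      case m: True
      then have m': "m mod p = p - Suc 0" by simp
      show ?thesis
      proof (cases "Suc (k' mod p) = p")
        case k: True
        then have "k' mod p = p - Suc 0" by simp
        \<comment> \<open>Both digits wrap: all low-digit factors are 1, and Pascal's rule is
          applied to the quotients.\<close>
        with m k m' show ?thesis
          by (simp add: Suc.IH mod_Suc div_Suc)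
      next
        case False
        then have "Suc (k' mod p) < p" using 1 by simp
        from carry[OF this] show ?thesis using m m' False
          by (simp add: Suc.IH mod_Suc div_Suc flip: distrib_right)
      qed
    next
      case m: False
      show ?thesis
      proof (cases "Suc (k' mod p) = p")
        case k: True
        then have "m mod p < k' mod p" using m 1 by linarith
        with m k show ?thesis
          by (simp add: Suc.IH mod_Suc div_Suc binomial_eq_0)
      next
        case False
        then show ?thesis using m
          by (simp add: Suc.IH mod_Suc div_Suc distrib_right)
      qed
    qed
    finally show ?thesis using Suc by simp
  qed simp
qed

lemma of_nat_binomial_mult_p:
  "(of_nat ((p * m) choose (p * k)) :: 'b) = of_nat (m choose k)"
  using p_gt_1 by (subst of_nat_binomial_lucas) simp

text \<open>The divided power y^j / j!; it has this meaning for j < p only, since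
  \<open>ifact\<close> is unspecified beyond.\<close>

definition divpow :: "'b \<Rightarrow> nat \<Rightarrow> 'b" where
  "divpow y j = ifact j * y ^ j"

lemma divpow_0 [simp]: "divpow y 0 = 1"
  by (simp add: divpow_def)

lemma divpow_mult:
  assumes "a + b < p"
  shows "divpow y a * divpow y b = of_nat ((a + b) choose b) * divpow y (a + b)"
proof -
  have ab: "a < p" "b < p" using assms by auto
  have "of_nat (fact a) * (of_nat (fact b) * (divpow y a * divpow y b)) = (of_nat (fact a) * ifact a) * (of_nat (fact b) * ifact b) * y ^ (a + b)"
    by (simp add: divpow_def power_add mult_ac del: of_nat_fact)
  also have "\<dots> = y ^ (a + b)"
    by (simp add: fact_ifact ab del: of_nat_fact)
  also have "\<dots> = of_nat (fact (a + b)) * divpow y (a + b)"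
    using fact_ifact[OF assms] by (simp add: divpow_def flip: mult.assoc)
  also have "(fact (a + b)::nat) = fact a * fact b * ((a + b) choose b)"
    using binomial_fact_lemma[of b "a + b"] by (simp add: mult_ac)
  finally have "of_nat (fact a) * (of_nat (fact b) * (divpow y a * divpow y b))
     = of_nat (fact a) * (of_nat (fact b) * (of_nat ((a + b) choose b) * divpow y (a + b)))"
    by (simp add: mult.assoc del: of_nat_fact)
  then show ?thesis
    using ifact_cancel ab by blast
qed

text \<open>The case of a carry, which matches the vanishing of the binomial in Lucas'
  theorem.\<close>

lemma divpow_mult_eq_0:
  assumes "y ^ p = 0" "p \<le> a + b"
  shows "divpow y a * divpow y b = 0"
proof -
  have "y ^ (a + b) = y ^ p * y ^ (a + b - p)"
    using assms(2) by (simp flip: power_add)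
  then have "y ^ a * y ^ b = 0"
    using assms(1) by (simp add: power_add)
  then show ?thesis
    by (simp add: divpow_def mult_ac)
qed

text \<open>A derivation is only required to be additive, so inverses of integers are not constants
  by definition: apply d to \<open>of_nat (fact j) * ifact j = 1\<close> and cancel j!.\<close>

lemma derivation_ifact:
  assumes d: "derivation d" and j: "j < p"
  shows "d (ifact j) = 0"
proof -
  have "d (of_nat (fact j) * ifact j) = 0"
    by (simp add: fact_ifact[OF j] derivation_1[OF d] del: of_nat_fact)
  then have "of_nat (fact j) * d (ifact j) = of_nat (fact j) * 0"
    by (simp add: derivation_mult[OF d] derivation_of_nat[OF d] del: of_nat_fact)
  then show ?thesis
    using ifact_cancel[OF j] by blast
qed

lemma derivation_divpow:
  assumes d: "derivation d" and j: "Suc j < p"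
  shows "d (divpow y (Suc j)) = divpow y j * d y"
proof -
  have "of_nat (fact j) * (of_nat (Suc j) * ifact (Suc j)) = of_nat (fact j) * ifact j"
    using fact_ifact[OF j] fact_ifact[of j] j by (simp add: algebra_simps)
  then have "of_nat (Suc j) * ifact (Suc j) = ifact j"
    using ifact_cancel[of j] j by simp
  then have "ifact j * y ^ j * d y = of_nat (Suc j) * ifact (Suc j) * y ^ j * d y"
    by simp
  then show ?thesis
    using j derivation_ifact[OF d j]
    by (simp add: divpow_def derivation_mult[OF d, of "ifact (Suc j)"] derivation_power[OF d] mult_ac
        del: power_Suc of_nat_Suc)
qed

text \<open>All inner binomials of the Leibniz expansion of a p-th power are divisible by p. The
  induction on s uses this for the derivation \<open>e\<close>.\<close>

lemma derivation_funpow_prime_power: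
  fixes d :: "'b \<Rightarrow> 'b"
  assumes "derivation d"
  shows "derivation (d ^^ (p ^ s))"
proof (induction s)
  case (Suc s)
  define e where "e = d ^^ (p ^ s)"
  have e: "derivation e" using Suc by (simp add: e_def)
  have "(e ^^ p) (x * y) = (e ^^ p) x * y + x * (e ^^ p) y" for x y
  proof -
    have "(e ^^ p) (x * y) = (\<Sum>k\<le>p. of_nat (p choose k) * (e ^^ k) x * (e ^^ (p - k)) y)"
      by (rule derivation_leibniz[OF e])
    also have "\<dots> = (\<Sum>k\<in>{0, p}. of_nat (p choose k) * (e ^^ k) x * (e ^^ (p - k)) y)"
    proof (rule sum.mono_neutral_right)
      show "\<forall>k\<in>{..p} - {0, p}. of_nat (p choose k) * (e ^^ k) x * (e ^^ (p - k)) y = 0"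
      proof
        fix k assume "k \<in> {..p} - {0, p}"
        then have "p dvd (p choose k)"
          using prime_p by (intro dvd_choose_prime) auto
        then show "of_nat (p choose k) * (e ^^ k) x * (e ^^ (p - k)) y = 0"
          by (simp add: of_nat_eq_0_if_dvd)
      qed
    qed auto
    also have "\<dots> = (e ^^ p) x * y + x * (e ^^ p) y"
      using p_gt_1 by (simp add: add.commute)
    finally show ?thesis .
  qed
  then have "derivation (e ^^ p)"
    by (simp add: derivation_def derivation_funpow_add[OF e])
  then show ?case
    by (simp add: e_def funpow_mult mult.commute)
qed (use assms in simp)

section \<open>Products of divided powers over base-p digits\<close>

definition digit_prod :: "nat \<Rightarrow> (nat \<Rightarrow> 'b) \<Rightarrow> nat \<Rightarrow> 'b" where
  "digit_prod m Y j = (\<Prod>k<m. divpow (Y k) (j div p ^ k mod p))"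

lemma digit_prod_0 [simp]: "digit_prod 0 Y j = 1"
  by (simp add: digit_prod_def)

lemma digit_prod_zero [simp]: "digit_prod m Y 0 = 1"
  by (simp add: digit_prod_def)

text \<open>Peeling off the lowest digit shifts \<open>Y\<close>. This is the same recursion as in
  \<open>of_nat_binomial_lucas\<close>, so the inductions on m generalize over
  \<open>Y\<close>.\<close>

lemma digit_prod_Suc:
  "digit_prod (Suc m) Y j = divpow (Y 0) (j mod p) * digit_prod m (Y \<circ> Suc) (j div p)"
  unfolding digit_prod_def by (subst prod.lessThan_Suc_shift) (simp add: div_mult2_eq)

lemma digit_prod_mono:
  assumes "j < p ^ m" "m \<le> m'"
  shows "digit_prod m' Y j = digit_prod m Y j"
proof -
  have "divpow (Y k) (j div p ^ k mod p) = 1" if "m \<le> k" for k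
  proof -
    have "p ^ m \<le> p ^ k" using that p_gt_1 by (simp add: power_increasing)
    then show ?thesis using assms(1) by simp
  qed
  then show ?thesis
    unfolding digit_prod_def by (intro prod.mono_neutral_right) (use assms(2) in auto)
qed

lemma less_power_p: "j < p ^ j"
  using p_gt_1 by (simp add: power_gt_expt)

lemma less_power_p_Suc: "j < p ^ Suc j"
proof -
  have "p ^ j \<le> p ^ Suc j"
    using p_gt_1 by (intro power_increasing) auto
  with less_power_p[of j] show ?thesis by linarith
qed

text \<open>Compare the lowest digits. Without a carry, \<open>divpow_mult\<close> and the induction
  hypothesis give the two factors of the Lucas product; with a carry both sides are 0.\<close>

lemma digit_prod_mult:
  assumes "\<And>k. Y k ^ p = 0" "a + b < p ^ m"
  shows "digit_prod m Y a * digit_prod m Y b = of_nat ((a + b) choose b) * digit_prod m Y (a + b)"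
  using assms
proof (induction m arbitrary: Y a b)
  case 0
  then show ?case by simp
next
  case (Suc m)
  let ?a = "a mod p" and ?b = "b mod p" and ?a' = "a div p" and ?b' = "b div p"
  have lt: "?a < p" "?b < p" using p_gt_1 by auto
  have div: "(a + b) div p < p ^ m"
    using Suc.prems(2) p_gt_1 by (simp add: less_mult_imp_div_less mult.commute)
  have split: "digit_prod (Suc m) Y a * digit_prod (Suc m) Y b
      = divpow (Y 0) ?a * divpow (Y 0) ?b * (digit_prod m (Y \<circ> Suc) ?a' * digit_prod m (Y \<circ> Suc) ?b')"
    by (simp add: digit_prod_Suc mult_ac)
  show ?case
  proof (cases "?a + ?b < p")
    case True
    then have ab: "(a + b) mod p = ?a + ?b" "(a + b) div p = ?a' + ?b'"
      using mod_add_eq[of a p b] div_add1_eq[of a b p] by simp_all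
    have "digit_prod m (Y \<circ> Suc) ?a' * digit_prod m (Y \<circ> Suc) ?b'
        = of_nat ((?a' + ?b') choose ?b') * digit_prod m (Y \<circ> Suc) (?a' + ?b')"
      by (rule Suc.IH) (use Suc.prems(1) div ab in auto)
    then show ?thesis
      unfolding split divpow_mult[OF True]
      by (simp add: digit_prod_Suc ab of_nat_binomial_lucas[of "a + b"] mult_ac)
  next
    case False
    \<comment> \<open>After a carry the lowest digit of a + b is smaller than that of b, so Lucas
      makes the binomial vanish.\<close>
    then have "(a + b) mod p = ?a + ?b - p"
      using lt mod_add_eq[of a p b] le_mod_geq[of p "?a + ?b"] mod_less[of "?a + ?b - p" p] by linarith
    then have "(a + b) mod p < ?b" using lt False by linarith
    then have "(of_nat ((a + b) choose b) :: 'b) = 0"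
      by (simp add: of_nat_binomial_lucas[of "a + b"] binomial_eq_0)
    then show ?thesis
      unfolding split using divpow_mult_eq_0[OF Suc.prems(1), of ?a ?b] False by simp
  qed
qed

text \<open>All m digits of p^m - 1 equal p - 1. Hence the product that is integrated in the
  recursion for y^[p^k] is y^[p^k - 1].\<close>

lemma digit_prod_power_minus_one:
  "digit_prod m Y (p ^ m - 1) = (\<Prod>k<m. divpow (Y k) (p - 1))"
proof (induction m arbitrary: Y)
  case (Suc m)
  have *: "p ^ Suc m - 1 = (p - 1) + p * (p ^ m - 1)"
    using p_gt_1 by (simp add: diff_mult_distrib2)
  have "(p ^ Suc m - 1) mod p = p - 1" "(p ^ Suc m - 1) div p = p ^ m - 1"
    unfolding * using p_gt_1 by (simp_all only: mod_mult_self2 div_mult_self2) simp_all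
  then show ?case
    unfolding digit_prod_Suc by (subst prod.lessThan_Suc_shift) (simp add: Suc[unfolded One_nat_def])
qed simp

lemma digit_prod_eq:
  assumes "j < p ^ m" "j < p ^ m'"
  shows "digit_prod m Y j = digit_prod m' Y j"
  using digit_prod_mono[OF assms(1)] digit_prod_mono[OF assms(2)] by (metis nat_le_linear)

text \<open>The factor \<open>c\<close> makes the hypothesis stable under dropping the lowest digit:
  it absorbs the factor \<open>divpow (Y 0) (p - 1)\<close> of \<open>d (Y (Suc k))\<close>.\<close>

lemma derivation_digit_prod:
  assumes d: "derivation d" and nil: "\<And>k. Y k ^ p = 0"
    and Y: "\<And>k. d (Y k) = c * (\<Prod>l<k. divpow (Y l) (p - 1))"
    and "0 < j" "j < p ^ m"
  shows "d (digit_prod m Y j) = c * digit_prod m Y (j - 1)"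
  using assms(2-)
proof (induction m arbitrary: Y c j)
  case 0
  then show ?case by simp
next
  case (Suc m)
  let ?j0 = "j mod p" and ?j' = "j div p" and ?Z = "Y \<circ> Suc"
  have lt: "?j0 < p" using p_gt_1 by simp
  have j': "?j' < p ^ m"
    using Suc.prems(4) p_gt_1 by (simp add: less_mult_imp_div_less mult.commute)
  have Z: "d (?Z k) = (c * divpow (Y 0) (p - 1)) * (\<Prod>l<k. divpow (?Z l) (p - 1))" for k
    using Suc.prems(2)[of "Suc k"] by (simp only: prod.lessThan_Suc_shift o_def mult.assoc)
  have dZ: "d (digit_prod m ?Z ?j')
      = (if ?j' = 0 then 0 else c * divpow (Y 0) (p - 1) * digit_prod m ?Z (?j' - 1))"
  proof (cases "?j' = 0")
    case False
    then show ?thesis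
      using Suc.IH[of ?Z "c * divpow (Y 0) (p - 1)" ?j', OF _ Z] Suc.prems(1) j'
      by (simp add: o_def)
  qed (simp add: derivation_1[OF d])
  have dY0: "d (Y 0) = c" using Suc.prems(2)[of 0] by simp
  show ?case
  proof (cases "?j0 = 0")
    case True
    \<comment> \<open>A borrow: j - 1 has lowest digit p - 1 and higher part \<open>?j' - 1\<close>.
      The factor \<open>divpow (Y 0) (p - 1)\<close> in \<open>dZ\<close> supplies that lowest
      digit.\<close>
    have "?j' \<noteq> 0"
    proof
      assume "?j' = 0"
      then have "j = 0" using True mod_mult_div_eq[of j p] by simp
      then show False using Suc.prems(3) by simp
    qed
    then obtain q where q: "?j' = Suc q" by (metis not0_implies_Suc)
    have "?j0 + p * ?j' = j" by simp
    then have "j = p * Suc q" using True q by (simp only: add_0)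
    then have *: "j - 1 = (p - 1) + p * q" using p_gt_1 by simp
    have "(j - 1) mod p = p - 1" "(j - 1) div p = q"
      unfolding * using p_gt_1 by (simp_all only: mod_mult_self2 div_mult_self2) simp_all
    then have "(j - 1) mod p = p - 1" "(j - 1) div p = ?j' - 1"
      using q by simp_all
    then show ?thesis
      using True \<open>?j' \<noteq> 0\<close> by (simp add: digit_prod_Suc dZ mult_ac)
  next
    case False
    then obtain i where i: "?j0 = Suc i" by (metis not0_implies_Suc)
    have "?j0 + p * ?j' = j" by simp
    then have "j = Suc i + p * ?j'" using i by (simp only:)
    then have *: "j - 1 = i + p * ?j'" by linarith
    have j1: "(j - 1) mod p = i" "(j - 1) div p = ?j'"
      unfolding * using i lt by (simp_all only: mod_mult_self2 div_mult_self2) simp_all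
    \<comment> \<open>No borrow: the term in which d hits the higher digits contains a power of
      \<open>Y 0\<close> with exponent at least p, so only the derivative of the lowest factor
      survives.\<close>
    have z: "divpow (Y 0) (Suc i) * divpow (Y 0) (p - 1) = 0"
      using Suc.prems(1) p_gt_1 by (intro divpow_mult_eq_0) auto
    have "divpow (Y 0) (Suc i) * d (digit_prod m ?Z ?j') = 0"
      using z by (simp add: dZ mult.assoc mult.left_commute[of _ c]) (metis mult.assoc mult_zero_left mult_zero_right)
    then show ?thesis
      using i lt by (simp add: digit_prod_Suc j1[unfolded One_nat_def] derivation_mult[OF d] derivation_divpow[OF d] dY0 mult_ac)
  qed
qed

section \<open>Sequences of divided powers and their members at powers of p\<close>

lemma divided_powers_shift:
  fixes z :: "nat \<Rightarrow> 'b"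
  assumes "divided_powers z"
  shows "divided_powers (\<lambda>j. z (p * j))"
  using assms unfolding divided_powers_def
  by (simp add: of_nat_binomial_mult_p flip: distrib_left)

lemma divided_powers_small:
  fixes z :: "nat \<Rightarrow> 'b"
  assumes "divided_powers z"
  shows "of_nat (fact j) * z j = z 1 ^ j"
proof (induction j)
  case (Suc j)
  have "z j * z 1 = of_nat (Suc j) * z (Suc j)"
    using assms unfolding divided_powers_def by (metis Suc_eq_plus1 binomial_1 One_nat_def add.commute)
  moreover have "of_nat (fact (Suc j)) * z (Suc j) = of_nat (fact j) * (of_nat (Suc j) * z (Suc j))"
    by (simp add: algebra_simps)
  ultimately have "of_nat (fact (Suc j)) * z (Suc j) = of_nat (fact j) * z j * z 1"
    by (simp only: mult.assoc)
  with Suc show ?case by (simp add: mult.commute)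
qed (use assms in \<open>simp add: divided_powers_def\<close>)

text \<open>For k = 0, z 1 ^ p = p! z p vanishes as p divides p!. The subsequence z (p * j) is again
  a sequence of divided powers, and passing to it raises k by one.\<close>

lemma divided_powers_nilpotent:
  fixes z :: "nat \<Rightarrow> 'b"
  assumes "divided_powers z"
  shows "z (p ^ k) ^ p = 0"
  using assms
proof (induction k arbitrary: z)
  case 0
  have "p dvd fact p" using prime_p by (simp add: prime_dvd_fact_iff)
  then show ?case
    using divided_powers_small[OF 0, of p] by (simp add: of_nat_eq_0_if_dvd del: of_nat_fact)
next
  case (Suc k)
  from Suc.IH[OF divided_powers_shift[OF Suc.prems]] show ?case by simp
qed

text \<open>Write j = j0 + p * j'. By Lucas, j choose p * j' is 1 in the ring, so z j is z j0 times
  z (p * j'). The first factor is a divided power of z 1, the second is treated by induction on the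
  shifted sequence.\<close>

lemma divided_powers_eq_digit_prod:
  fixes z :: "nat \<Rightarrow> 'b"
  assumes "divided_powers z" "j < p ^ m"
  shows "z j = digit_prod m (\<lambda>k. z (p ^ k)) j"
  using assms
proof (induction m arbitrary: z j)
  case 0
  then show ?case by (simp add: divided_powers_def)
next
  case (Suc m)
  let ?j0 = "j mod p" and ?j' = "j div p"
  have lt: "?j0 < p" using p_gt_1 by simp
  have j': "?j' < p ^ m"
    using Suc.prems(2) p_gt_1 by (simp add: less_mult_imp_div_less mult.commute)
  have IH: "z (p * ?j') = digit_prod m ((\<lambda>k. z (p ^ k)) \<circ> Suc) ?j'"
    using Suc.IH[OF divided_powers_shift[OF Suc.prems(1)] j'] by (simp add: o_def)
  have "of_nat (fact ?j0) * z ?j0 = of_nat (fact ?j0) * divpow (z 1) ?j0"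
    using divided_powers_small[OF Suc.prems(1)] fact_ifact[OF lt]
    by (simp add: divpow_def flip: mult.assoc)
  then have z0: "z ?j0 = divpow (z 1) ?j0"
    using ifact_cancel lt by blast
  have "(of_nat ((?j0 + p * ?j') choose (p * ?j')) :: 'b) = 1"
    using lt by (subst of_nat_binomial_lucas) simp
  then have "z ?j0 * z (p * ?j') = z j"
    using Suc.prems(1) unfolding divided_powers_def by simp
  then show ?case
    by (simp add: digit_prod_Suc z0 IH)
qed

end

section \<open>The ring of scalar differential operators in countably many variables\<close>

lemma zero_mi_eq_0: "zero_mi = 0"
  by (simp add: zero_mi_def zero_fun_def)

lemma Dn_mono: "n \<le> m \<Longrightarrow> Dn n \<subseteq> Dn m"
  by (auto simp: Dn_def mi_def)

lemma mi_add_iff: "mi n (\<alpha> + \<beta>) \<longleftrightarrow> mi n \<alpha> \<and> mi n \<beta>"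
  by (auto simp: mi_def)

text \<open>The union over all \<open>n\<close> is a type not depending on \<open>n\<close>, hence can be made an instance of
  \<open>comm_ring_1\<close>.\<close>

typedef (overloaded) 'a dalg = "\<Union>n. Dn n :: 'a::field dop set"
  morphisms coef Abs_dalg
proof
  show "dzero \<in> (\<Union>n. Dn n)" by (auto simp: Dn_def dzero_def)
qed

setup_lifting type_definition_dalg

lemma dalg_eqI: "(\<And>\<alpha>. coef f \<alpha> = coef g \<alpha>) \<Longrightarrow> f = g"
  by (metis coef_inject ext)

text \<open>Summing over pairs, instead of subtracting indices as \<open>dmul\<close> does, turns
  commutativity and associativity into reindexings.\<close>

definition splits :: "(nat \<Rightarrow> nat) \<Rightarrow> ((nat \<Rightarrow> nat) \<times> (nat \<Rightarrow> nat)) set" where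
  "splits \<gamma> = {(\<alpha>, \<beta>). \<alpha> + \<beta> = \<gamma>}"

text \<open>The product runs over the support so that \<open>conv\<close> does not depend on \<open>n\<close>, unlike \<open>dmul n\<close>,
  with which it agrees on \<open>Dn n\<close>.\<close>

definition binom_mi :: "(nat \<Rightarrow> nat) \<Rightarrow> (nat \<Rightarrow> nat) \<Rightarrow> nat" where
  "binom_mi \<alpha> \<beta> = (\<Prod>i | \<alpha> i + \<beta> i \<noteq> 0. (\<alpha> i + \<beta> i) choose \<beta> i)"

definition conv :: "'a::field dop \<Rightarrow> 'a dop \<Rightarrow> 'a dop" where
  "conv f g \<gamma> = (\<Sum>(\<alpha>, \<beta>)\<in>splits \<gamma>. of_nat (binom_mi \<alpha> \<beta>) * f \<alpha> * g \<beta>)"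

lemma binom_mi_superset:
  assumes "finite I" "\<And>i. i \<notin> I \<Longrightarrow> \<alpha> i + \<beta> i = 0"
  shows "binom_mi \<alpha> \<beta> = (\<Prod>i\<in>I. (\<alpha> i + \<beta> i) choose \<beta> i)"
proof -
  have "{i. \<alpha> i + \<beta> i \<noteq> 0} \<subseteq> I"
    by (rule subsetI, rule ccontr) (use assms(2) in simp)
  then show ?thesis
    unfolding binom_mi_def by (intro prod.mono_neutral_left) (use assms(1) in auto)
qed

lemma binom_mi_eq_prod: "mi n \<alpha> \<Longrightarrow> mi n \<beta> \<Longrightarrow> binom_mi \<alpha> \<beta> = (\<Prod>i<n. (\<alpha> i + \<beta> i) choose \<beta> i)"
  by (rule binom_mi_superset) (auto simp: mi_def)

lemma mbinom_eq_binom_mi: "mi n \<alpha> \<Longrightarrow> mi n \<beta> \<Longrightarrow> mbinom n (\<alpha> + \<beta>) \<beta> = binom_mi \<alpha> \<beta>"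
  by (simp add: binom_mi_eq_prod mbinom_def)

lemma binom_mi_assoc:
  assumes "mi n \<alpha>" "mi n \<beta>" "mi n \<gamma>"
  shows "binom_mi \<alpha> \<beta> * binom_mi (\<alpha> + \<beta>) \<gamma> = binom_mi \<beta> \<gamma> * binom_mi \<alpha> (\<beta> + \<gamma>)"
proof -
  have choose: "((a + b) choose b) * ((a + b + c) choose c) = ((b + c) choose c) * ((a + (b + c)) choose (b + c))"
    for a b c :: nat
    using choose_mult[of c "b + c" "a + b + c"] by (simp add: mult.commute add.assoc)
  show ?thesis
    using assms
    by (simp add: binom_mi_eq_prod[of n] mi_add_iff choose flip: prod.distrib)
qed

lemma binom_mi_commute: "binom_mi \<alpha> \<beta> = binom_mi \<beta> \<alpha>"
proof -
  have "(\<alpha> i + \<beta> i) choose \<beta> i = (\<beta> i + \<alpha> i) choose \<alpha> i" for i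
    using binomial_symmetric[of "\<alpha> i" "\<alpha> i + \<beta> i"] by (simp add: add.commute)
  then show ?thesis
    by (simp add: binom_mi_def add.commute)
qed

lemma binom_mi_0 [simp]: "binom_mi 0 \<beta> = 1"
  by (simp add: binom_mi_def)

lemma splits_image: "splits \<gamma> = (\<lambda>\<beta>. (\<lambda>i. \<gamma> i - \<beta> i, \<beta>)) ` {\<beta>. \<forall>i. \<beta> i \<le> \<gamma> i}"
proof -
  have "(\<alpha>, \<beta>) \<in> (\<lambda>\<beta>. (\<lambda>i. \<gamma> i - \<beta> i, \<beta>)) ` {\<beta>. \<forall>i. \<beta> i \<le> \<gamma> i}" if "\<gamma> = \<alpha> + \<beta>" for \<alpha> \<beta>
    using that by (intro image_eqI[of _ _ \<beta>]) auto
  then show ?thesis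
    by (fastforce simp: splits_def)
qed

text \<open>An index of infinite support has infinitely many splittings, and \<open>sum\<close> then
  returns its default value 0; arguments that manipulate the sums are confined to N^n.\<close>

lemma finite_splits:
  assumes "mi n \<gamma>"
  shows "finite (splits \<gamma>)"
proof -
  have "{\<beta>. \<forall>i. \<beta> i \<le> \<gamma> i} \<subseteq> {f. \<forall>i. (i \<in> {..<n} \<longrightarrow> f i \<in> {..\<Sum>i<n. \<gamma> i}) \<and> (i \<notin> {..<n} \<longrightarrow> f i = 0)}"
  proof (safe, goal_cases)
    case (1 \<beta> i)
    then have "\<beta> i \<le> \<gamma> i" "\<gamma> i \<le> (\<Sum>i<n. \<gamma> i)"
      by (auto intro: member_le_sum)
    then show ?case by simp
  next
    case (2 \<beta> i)
    with assms show ?case by (metis mi_def lessThan_iff linorder_not_less le_zero_eq)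
  qed
  then have "finite {\<beta>. \<forall>i. \<beta> i \<le> \<gamma> i}"
    by (rule finite_subset) (intro finite_set_of_finite_funs; simp)
  then show ?thesis by (simp add: splits_image)
qed

section \<open>Convolution: closure of D_n and the ring laws\<close>

lemma conv_nonzero:
  assumes "conv f g \<gamma> \<noteq> 0"
  obtains \<alpha> \<beta> where "\<alpha> + \<beta> = \<gamma>" "f \<alpha> \<noteq> 0" "g \<beta> \<noteq> 0"
proof -
  from assms obtain x where x: "x \<in> splits \<gamma>" "(case x of (\<alpha>, \<beta>) \<Rightarrow> of_nat (binom_mi \<alpha> \<beta>) * f \<alpha> * g \<beta>) \<noteq> 0"
    unfolding conv_def by (meson sum.not_neutral_contains_not_neutral)
  then show ?thesis
    using that by (auto simp: splits_def)
qed

lemma conv_Dn: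
  assumes "f \<in> Dn n" "g \<in> Dn n"
  shows "conv f g \<in> Dn n"
proof -
  have "{\<gamma>. conv f g \<gamma> \<noteq> 0} \<subseteq> (\<lambda>(\<alpha>, \<beta>). \<alpha> + \<beta>) ` ({\<alpha>. f \<alpha> \<noteq> 0} \<times> {\<beta>. g \<beta> \<noteq> 0})"
    by (auto elim!: conv_nonzero)
  then have "finite {\<gamma>. conv f g \<gamma> \<noteq> 0}"
    by (rule finite_subset) (use assms in \<open>auto simp: Dn_def\<close>)
  moreover have "mi n \<gamma>" if "conv f g \<gamma> \<noteq> 0" for \<gamma>
    using that assms by (auto simp: Dn_def mi_add_iff elim!: conv_nonzero)
  ultimately show ?thesis
    by (simp add: Dn_def)
qed

text \<open>The binomial factors agree whenever both coefficients are nonzero, because both indices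
  then lie in N^n.\<close>

lemma conv_eq_dmul:
  assumes "f \<in> Dn n" "g \<in> Dn n"
  shows "dmul n f g = conv f g"
proof
  fix \<gamma>
  have "conv f g \<gamma> = (\<Sum>\<beta> | \<forall>i. \<beta> i \<le> \<gamma> i. of_nat (binom_mi (\<lambda>i. \<gamma> i - \<beta> i) \<beta>) * f (\<lambda>i. \<gamma> i - \<beta> i) * g \<beta>)"
    unfolding conv_def splits_image by (subst sum.reindex) (auto simp: inj_on_def)
  also have "\<dots> = dmul n f g \<gamma>"
    unfolding dmul_def
  proof (rule sum.cong[OF refl])
    fix \<beta> assume "\<beta> \<in> {\<beta>. \<forall>i. \<beta> i \<le> \<gamma> i}"
    then have \<gamma>: "(\<lambda>i. \<gamma> i - \<beta> i) + \<beta> = \<gamma>" by (auto simp: fun_eq_iff)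
    show "of_nat (binom_mi (\<lambda>i. \<gamma> i - \<beta> i) \<beta>) * f (\<lambda>i. \<gamma> i - \<beta> i) * g \<beta>
        = of_nat (mbinom n \<gamma> \<beta>) * f (\<lambda>i. \<gamma> i - \<beta> i) * g \<beta>"
    proof (cases "f (\<lambda>i. \<gamma> i - \<beta> i) = 0 \<or> g \<beta> = 0")
      case False
      then have "mi n (\<lambda>i. \<gamma> i - \<beta> i)" "mi n \<beta>" using assms by (auto simp: Dn_def)
      from mbinom_eq_binom_mi[OF this] show ?thesis by (simp add: \<gamma>)
    qed auto
  qed
  finally show "dmul n f g \<gamma> = conv f g \<gamma>" by simp
qed

lemma mi_splits: "mi n \<gamma> \<Longrightarrow> (\<alpha>, \<beta>) \<in> splits \<gamma> \<Longrightarrow> mi n \<alpha> \<and> mi n \<beta>"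
  by (auto simp: splits_def mi_add_iff)

lemma conv_eq_0_outside: "f \<in> Dn n \<Longrightarrow> g \<in> Dn n \<Longrightarrow> \<not> mi n \<gamma> \<Longrightarrow> conv f g \<gamma> = 0"
  using conv_Dn[of f n g] by (auto simp: Dn_def)

lemma conv_assoc:
  assumes "f \<in> Dn n" "g \<in> Dn n" "h \<in> Dn n"
  shows "conv (conv f g) h = conv f (conv g h)"
proof
  fix \<delta>
  show "conv (conv f g) h \<delta> = conv f (conv g h) \<delta>"
  proof (cases "mi n \<delta>")
    case False
    then show ?thesis
      using conv_eq_0_outside conv_Dn assms by metis
  next
    case mi: True
    have fin: "finite (splits (fst x))" "finite (splits (snd x))" if "x \<in> splits \<delta>" for x
      using that mi_splits[OF mi, of "fst x" "snd x"] finite_splits by auto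
    have "conv (conv f g) h \<delta> = (\<Sum>x\<in>splits \<delta>. \<Sum>y\<in>splits (fst x).
        of_nat (binom_mi (fst x) (snd x) * binom_mi (fst y) (snd y)) * f (fst y) * g (snd y) * h (snd x))"
      by (simp add: conv_def case_prod_unfold sum_distrib_left sum_distrib_right mult_ac)
    also have "\<dots> = (\<Sum>(x, y)\<in>Sigma (splits \<delta>) (splits \<circ> fst).
        of_nat (binom_mi (fst x) (snd x) * binom_mi (fst y) (snd y)) * f (fst y) * g (snd y) * h (snd x))"
      using fin finite_splits[OF mi] by (subst sum.Sigma) (auto simp: o_def case_prod_unfold)
    also have "\<dots> = (\<Sum>(x, y)\<in>Sigma (splits \<delta>) (splits \<circ> snd).
        of_nat (binom_mi (fst x) (snd x) * binom_mi (fst y) (snd y)) * f (fst x) * g (fst y) * h (snd y))"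
    \<comment> \<open>Both index sets describe the triples with sum \<delta>, bracketed to the left
      and to the right.\<close>
    proof (rule sum.reindex_bij_witness[where
          i = "\<lambda>((\<alpha>, _), (\<beta>, \<gamma>)). ((\<alpha> + \<beta>, \<gamma>), (\<alpha>, \<beta>))" and
          j = "\<lambda>((_, \<gamma>), (\<alpha>, \<beta>)). ((\<alpha>, \<beta> + \<gamma>), (\<beta>, \<gamma>))"], goal_cases)
      case (5 a)
      obtain \<epsilon> \<gamma> \<alpha> \<beta> where a: "a = ((\<epsilon>, \<gamma>), (\<alpha>, \<beta>))" by (metis prod.collapse)
      with 5 have "\<epsilon> = \<alpha> + \<beta>" "mi n \<alpha>" "mi n \<beta>" "mi n \<gamma>"
        using mi by (auto simp: splits_def mi_add_iff)
      then show ?case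
        using binom_mi_assoc[of n \<alpha> \<beta> \<gamma>] by (simp add: a mult.commute flip: of_nat_mult)
    qed (auto simp: splits_def add.assoc)
    also have "\<dots> = (\<Sum>x\<in>splits \<delta>. \<Sum>y\<in>splits (snd x).
        of_nat (binom_mi (fst x) (snd x) * binom_mi (fst y) (snd y)) * f (fst x) * g (fst y) * h (snd y))"
      using fin finite_splits[OF mi] by (subst sum.Sigma) (auto simp: o_def case_prod_unfold)
    also have "\<dots> = conv f (conv g h) \<delta>"
      by (simp add: conv_def case_prod_unfold sum_distrib_left sum_distrib_right mult_ac)
    finally show ?thesis .
  qed
qed

lemma conv_commute: "conv f g = conv g f"
proof
  fix \<gamma>
  show "conv f g \<gamma> = conv g f \<gamma>"
    unfolding conv_def
    by (rule sum.reindex_bij_witness[where i = prod.swap and j = prod.swap])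
      (auto simp: splits_def add.commute binom_mi_commute mult_ac)
qed

text \<open>The case c = 1 is the unit law; general c identifies \<open>dscale\<close> with
  multiplication by a constant operator.\<close>

lemma conv_scalar:
  assumes "f \<in> Dn n"
  shows "conv (\<lambda>\<alpha>. if \<alpha> = 0 then c else 0) f = dscale c f"
proof
  fix \<gamma>
  show "conv (\<lambda>\<alpha>. if \<alpha> = 0 then c else 0) f \<gamma> = dscale c f \<gamma>"
  proof (cases "mi n \<gamma>")
    case True
    have "conv (\<lambda>\<alpha>. if \<alpha> = 0 then c else 0) f \<gamma> = (\<Sum>(\<alpha>, \<beta>)\<in>{(0, \<gamma>)}. of_nat (binom_mi \<alpha> \<beta>) * (if \<alpha> = 0 then c else 0) * f \<beta>)"
      unfolding conv_def
      by (rule sum.mono_neutral_right) (use finite_splits[OF True] in \<open>auto simp: splits_def split: if_splits\<close>)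
    then show ?thesis by (simp add: dscale_def)
  next
    case False
    have "(\<lambda>\<alpha>. if \<alpha> = 0 then c else 0) \<in> Dn n"
      by (auto simp: Dn_def mi_def)
    with False assms show ?thesis
      by (subst conv_eq_0_outside) (auto simp: dscale_def Dn_def)
  qed
qed

lemma dadd_Dn:
  assumes "f \<in> Dn n" "g \<in> Dn n"
  shows "dadd f g \<in> Dn n"
proof -
  have "{\<alpha>. dadd f g \<alpha> \<noteq> 0} \<subseteq> {\<alpha>. f \<alpha> \<noteq> 0} \<union> {\<alpha>. g \<alpha> \<noteq> 0}"
    by (auto simp: dadd_def)
  moreover have "finite ({\<alpha>. f \<alpha> \<noteq> 0} \<union> {\<alpha>. g \<alpha> \<noteq> 0})"
    using assms by (simp add: Dn_def)
  ultimately show ?thesis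
    using assms finite_subset by (fastforce simp: Dn_def)
qed

lemma dscale_Dn:
  assumes "f \<in> Dn n"
  shows "dscale c f \<in> Dn n"
proof -
  have "{\<alpha>. dscale c f \<alpha> \<noteq> 0} \<subseteq> {\<alpha>. f \<alpha> \<noteq> 0}"
    by (auto simp: dscale_def)
  then show ?thesis
    using assms finite_subset by (fastforce simp: Dn_def)
qed

lemma dsub_eq: "dsub f g = dadd f (dscale (-1) g)"
  by (simp add: dsub_def dadd_def dscale_def)

lemma dunit_Dn: "dunit \<in> Dn n"
  by (auto simp: dunit_def dpb_def Dn_def zero_mi_def mi_def)

lemma dzero_Dn: "dzero \<in> Dn n"
  by (auto simp: dzero_def Dn_def)

lemma Dn_common:
  assumes "f \<in> (\<Union>n. Dn n)" "g \<in> (\<Union>n. Dn n)"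
  obtains n where "f \<in> Dn n" "g \<in> Dn n"
proof -
  from assms obtain k l where "f \<in> Dn k" "g \<in> Dn l" by blast
  then show ?thesis
    using that[of "max k l"] Dn_mono[of k "max k l"] Dn_mono[of l "max k l"] by auto
qed

section \<open>The commutative ring of operators and its constants\<close>

instantiation dalg :: (field) comm_ring_1
begin

lift_definition zero_dalg :: "'a dalg" is dzero
  using dzero_Dn by blast

lift_definition one_dalg :: "'a dalg" is dunit
  using dunit_Dn by blast

lift_definition plus_dalg :: "'a dalg \<Rightarrow> 'a dalg \<Rightarrow> 'a dalg" is dadd
  by (erule (1) Dn_common, rule UN_I[OF UNIV_I], rule dadd_Dn)

lift_definition uminus_dalg :: "'a dalg \<Rightarrow> 'a dalg" is "dscale (-1)"
  by (auto intro: dscale_Dn)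

lift_definition minus_dalg :: "'a dalg \<Rightarrow> 'a dalg \<Rightarrow> 'a dalg" is dsub
  unfolding dsub_eq by (erule (1) Dn_common, rule UN_I[OF UNIV_I], rule dadd_Dn[OF _ dscale_Dn])

lift_definition times_dalg :: "'a dalg \<Rightarrow> 'a dalg \<Rightarrow> 'a dalg" is conv
  by (erule (1) Dn_common, rule UN_I[OF UNIV_I], rule conv_Dn)

instance
proof
  fix a b c :: "'a dalg"
  show "a * b * c = a * (b * c)"
  proof transfer
    fix a b c :: "'a dop"
    assume "a \<in> (\<Union>n. Dn n)" "b \<in> (\<Union>n. Dn n)" "c \<in> (\<Union>n. Dn n)"
    then obtain n m k where "a \<in> Dn n" "b \<in> Dn m" "c \<in> Dn k" by blast
    then have "a \<in> Dn (n + m + k)" "b \<in> Dn (n + m + k)" "c \<in> Dn (n + m + k)"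
      using Dn_mono[of n "n + m + k"] Dn_mono[of m "n + m + k"] Dn_mono[of k "n + m + k"] by auto
    then show "conv (conv a b) c = conv a (conv b c)" by (rule conv_assoc)
  qed
  show "a * b = b * a" by transfer (rule conv_commute)
  show "1 * a = a"
  proof transfer
    fix a :: "'a dop" assume "a \<in> (\<Union>n. Dn n)"
    then show "conv dunit a = a"
      using conv_scalar[of a _ 1] by (auto simp: dunit_def dpb_def zero_mi_eq_0 dscale_def)
  qed
  show "(a + b) * c = a * c + b * c"
    by transfer (auto simp: conv_def dadd_def algebra_simps sum.distrib case_prod_unfold fun_eq_iff)
  show "(0::'a dalg) \<noteq> 1"
    by transfer (auto simp: dzero_def dunit_def dpb_def fun_eq_iff)
  show "a + b + c = a + (b + c)" by transfer (simp add: dadd_def add.assoc)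
  show "a + b = b + a" by transfer (simp add: dadd_def add.commute)
  show "0 + a = a" by transfer (simp add: dadd_def dzero_def)
  show "- a + a = 0" by transfer (simp add: dadd_def dzero_def dscale_def)
  show "a - b = a + - b" by transfer (simp add: dadd_def dsub_def dscale_def)
qed

end

lift_definition const :: "'a::field \<Rightarrow> 'a dalg" is "\<lambda>c \<alpha>. if \<alpha> = 0 then c else 0"
  by (rule UN_I[of 0]) (auto simp: Dn_def mi_def)

lemma coef_const_mult: "coef (const c * f) = dscale c (coef f)"
  by transfer (auto simp: conv_scalar)

lemma const_1 [simp]: "const 1 = 1"
  by transfer (auto simp: dunit_def dpb_def zero_mi_eq_0)

lemma const_add: "const (a + b) = const a + const b"
  by transfer (auto simp: dadd_def)

lemma const_0 [simp]: "const 0 = 0"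
  by transfer (auto simp: dzero_def)

lemma const_mult: "const (a * b) = const a * const b"
  by (rule dalg_eqI) (simp add: coef_const_mult dscale_def const.rep_eq)

lemma of_nat_dalg: "of_nat m = const (of_nat m)"
  by (induction m) (simp_all add: const_add)

text \<open>The index 0 splits only as 0 + 0. Multiplicativity of the constant term forces it to be
  0 for nilpotent operators.\<close>

lemma coef_0_mult: "coef (f * g) 0 = coef f 0 * coef g 0"
proof -
  have "splits 0 = {(0, 0)}"
    by (auto simp: splits_def fun_eq_iff)
  then show ?thesis
    by (simp add: times_dalg.rep_eq conv_def)
qed

lemma coef_0_power: "coef (f ^ k) 0 = coef f 0 ^ k"
proof (induction k)
  case 0
  show ?case by (simp add: one_dalg.rep_eq dunit_def dpb_def zero_mi_def zero_fun_def)
qed (simp only: power_Suc coef_0_mult)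

subsection \<open>The derivations and the dual integrations\<close>

lemma inj_fun_upd_Suc: "inj (\<lambda>\<alpha>::nat \<Rightarrow> nat. \<alpha>(i := Suc (\<alpha> i)))"
  by (rule injI) (metis fun_upd_same fun_upd_triv fun_upd_upd old.nat.inject)

lemma delta_Dn:
  assumes "f \<in> Dn n"
  shows "delta i f \<in> Dn n"
proof -
  have "finite ((\<lambda>\<alpha>. \<alpha>(i := Suc (\<alpha> i))) -` {\<alpha>. f \<alpha> \<noteq> 0})"
    using assms by (intro finite_vimageI inj_fun_upd_Suc) (simp add: Dn_def)
  moreover have "mi n \<alpha>" if "f (\<alpha>(i := Suc (\<alpha> i))) \<noteq> 0" for \<alpha>
  proof -
    have "mi n (\<alpha>(i := Suc (\<alpha> i)))" using that assms by (simp add: Dn_def)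
    then show ?thesis by (auto simp: mi_def split: if_splits)
  qed
  ultimately show ?thesis
    by (simp add: Dn_def delta_def vimage_def)
qed

lemma dint_Dn:
  assumes "f \<in> Dn n" "i < n"
  shows "dint i f \<in> Dn n"
proof -
  have "{\<alpha>. dint i f \<alpha> \<noteq> 0} \<subseteq> (\<lambda>\<alpha>. \<alpha>(i := Suc (\<alpha> i))) ` {\<alpha>. f \<alpha> \<noteq> 0}"
  proof
    fix \<alpha> assume "\<alpha> \<in> {\<alpha>. dint i f \<alpha> \<noteq> 0}"
    then have "\<alpha> i \<noteq> 0" "f (\<alpha>(i := \<alpha> i - 1)) \<noteq> 0" by (auto simp: dint_def split: if_splits)
    then show "\<alpha> \<in> (\<lambda>\<alpha>. \<alpha>(i := Suc (\<alpha> i))) ` {\<alpha>. f \<alpha> \<noteq> 0}"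
      by (intro image_eqI[of _ _ "\<alpha>(i := \<alpha> i - 1)"]) auto
  qed
  then have "finite {\<alpha>. dint i f \<alpha> \<noteq> 0}"
    by (rule finite_subset) (use assms in \<open>auto simp: Dn_def\<close>)
  moreover have "mi n \<alpha>" if "dint i f \<alpha> \<noteq> 0" for \<alpha>
  proof -
    have "mi n (\<alpha>(i := \<alpha> i - 1))" using that assms by (auto simp: Dn_def dint_def split: if_splits)
    then show ?thesis using assms(2) by (auto simp: mi_def)
  qed
  ultimately show ?thesis
    by (simp add: Dn_def)
qed

lift_definition ddelta :: "nat \<Rightarrow> 'a::field dalg \<Rightarrow> 'a dalg" is delta
  by (auto intro: delta_Dn)

lift_definition ddint :: "nat \<Rightarrow> 'a::field dalg \<Rightarrow> 'a dalg" is dint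
proof -
  fix i and f :: "'a dop" assume "f \<in> (\<Union>n. Dn n)"
  then obtain n where "f \<in> Dn n" by blast
  \<comment> \<open>Enlarging the number of variables brings variable i among them, as
    \<open>dint_Dn\<close> requires.\<close>
  then have "f \<in> Dn (n + Suc i)" using Dn_mono[of n "n + Suc i"] by auto
  then show "dint i f \<in> (\<Union>n. Dn n)" using dint_Dn[of f "n + Suc i" i] by auto
qed

text \<open>Pascal's rule in coordinate i, the other coordinates contributing the common factor
  \<open>R\<close>. This is the Leibniz rule for \<open>delta i\<close> on basis elements.\<close>

lemma binom_mi_pascal:
  assumes "mi n \<alpha>" "mi n \<beta>" "\<alpha> + \<beta> = \<gamma>(i := Suc (\<gamma> i))"
  shows "binom_mi \<alpha> \<beta> = (if \<alpha> i = 0 then 0 else binom_mi (\<alpha>(i := \<alpha> i - 1)) \<beta>)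
    + (if \<beta> i = 0 then 0 else binom_mi \<alpha> (\<beta>(i := \<beta> i - 1)))"
proof -
  define I where "I = {..<n} - {i}"
  define R where "R = (\<Prod>j\<in>I. (\<alpha> j + \<beta> j) choose \<beta> j)"
  have split: "binom_mi \<alpha>' \<beta>' = ((\<alpha>' i + \<beta>' i) choose \<beta>' i) * R"
    if "\<And>j. j \<noteq> i \<Longrightarrow> \<alpha>' j = \<alpha> j \<and> \<beta>' j = \<beta> j" for \<alpha>' \<beta>'
  proof -
    have "binom_mi \<alpha>' \<beta>' = (\<Prod>j\<in>insert i I. (\<alpha>' j + \<beta>' j) choose \<beta>' j)"
      by (rule binom_mi_superset) (use assms that in \<open>auto simp: I_def mi_def\<close>)
    also have "\<dots> = ((\<alpha>' i + \<beta>' i) choose \<beta>' i) * (\<Prod>j\<in>I. (\<alpha>' j + \<beta>' j) choose \<beta>' j)"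
      by (rule prod.insert) (auto simp: I_def)
    also have "(\<Prod>j\<in>I. (\<alpha>' j + \<beta>' j) choose \<beta>' j) = R"
      unfolding R_def by (rule prod.cong) (use that in \<open>auto simp: I_def\<close>)
    finally show ?thesis .
  qed
  have "\<alpha> i + \<beta> i \<noteq> 0" using assms(3) by (metis fun_upd_same nat.distinct(1) plus_fun_apply)
  then have "(\<alpha> i + \<beta> i) choose \<beta> i = (if \<alpha> i = 0 then 0 else (\<alpha> i - 1 + \<beta> i) choose \<beta> i)
      + (if \<beta> i = 0 then 0 else (\<alpha> i + (\<beta> i - 1)) choose (\<beta> i - 1))"
    by (cases "\<alpha> i"; cases "\<beta> i") (auto simp: binomial_eq_0)
  then show ?thesis
    by (simp add: split distrib_right)
qed

text \<open>Each splitting of \<gamma> + e_i is weighted by Pascal's rule: one part removes e_i from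
  \<alpha> and sums to the first convolution, the other removes it from \<beta> and sums to the
  second.\<close>

lemma delta_conv:
  fixes f g :: "'a::field dop"
  assumes "f \<in> Dn n" "g \<in> Dn n"
  shows "delta i (conv f g) = dadd (conv (delta i f) g) (conv f (delta i g))"
proof
  fix \<gamma>
  let ?up = "\<lambda>\<alpha>::nat \<Rightarrow> nat. \<alpha>(i := Suc (\<alpha> i))" and ?down = "\<lambda>\<alpha>::nat \<Rightarrow> nat. \<alpha>(i := \<alpha> i - 1)"
  define S where "S = splits (?up \<gamma>)"
  show "delta i (conv f g) \<gamma> = dadd (conv (delta i f) g) (conv f (delta i g)) \<gamma>"
  proof (cases "mi n (?up \<gamma>)")
    \<comment> \<open>Outside N^n the index sets may be infinite, so this case is separate: every
      term vanishes.\<close>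
    case False
    show ?thesis
    proof -
      have "f \<alpha> = 0 \<or> g \<beta> = 0" if "\<alpha> + \<beta> = ?up \<gamma>" for \<alpha> \<beta>
        using that False assms mi_add_iff[of n \<alpha> \<beta>] by (auto simp: Dn_def)
      moreover have "?up \<alpha> + \<beta> = ?up (\<alpha> + \<beta>)" "\<alpha> + ?up \<beta> = ?up (\<alpha> + \<beta>)" for \<alpha> \<beta>
        by auto
      ultimately have "f (?up \<alpha>) = 0 \<or> g \<beta> = 0" "f \<alpha> = 0 \<or> g (?up \<beta>) = 0" if "\<alpha> + \<beta> = \<gamma>" for \<alpha> \<beta>
        using that by metis+
      then have "conv (delta i f) g \<gamma> = 0" "conv f (delta i g) \<gamma> = 0"
        unfolding conv_def by (auto simp: splits_def delta_def intro!: sum.neutral)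
      moreover have "delta i (conv f g) \<gamma> = 0"
        using conv_eq_0_outside[OF assms False] by (simp add: delta_def)
      ultimately show ?thesis by (simp add: dadd_def)
    qed
  next
    case mi: True
    have fin: "finite S" unfolding S_def using finite_splits[OF mi] .
    have upd: "?up (\<alpha> + \<beta>) = ?up \<alpha> + \<beta>" "?up (\<alpha> + \<beta>) = \<alpha> + ?up \<beta>" for \<alpha> \<beta>
      by auto
    have "delta i (conv f g) \<gamma> = (\<Sum>(\<alpha>, \<beta>)\<in>S. of_nat (binom_mi \<alpha> \<beta>) * f \<alpha> * g \<beta>)"
      by (simp add: delta_def conv_def S_def)
    also have "\<dots> = (\<Sum>(\<alpha>, \<beta>)\<in>S. (if \<alpha> i = 0 then 0 else of_nat (binom_mi (?down \<alpha>) \<beta>) * f \<alpha> * g \<beta>)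
        + (if \<beta> i = 0 then 0 else of_nat (binom_mi \<alpha> (?down \<beta>)) * f \<alpha> * g \<beta>))"
    proof (rule sum.cong[OF refl], clarify)
      fix \<alpha> \<beta> assume "(\<alpha>, \<beta>) \<in> S"
      then have "mi n \<alpha>" "mi n \<beta>" "\<alpha> + \<beta> = ?up \<gamma>"
        using mi_splits[OF mi] by (auto simp: S_def splits_def)
      from binom_mi_pascal[OF this]
      show "of_nat (binom_mi \<alpha> \<beta>) * f \<alpha> * g \<beta> = (if \<alpha> i = 0 then 0 else of_nat (binom_mi (?down \<alpha>) \<beta>) * f \<alpha> * g \<beta>)
        + (if \<beta> i = 0 then 0 else of_nat (binom_mi \<alpha> (?down \<beta>)) * f \<alpha> * g \<beta>)"
        by (simp add: distrib_right)
    qed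
    also have "\<dots> = (\<Sum>(\<alpha>, \<beta>)\<in>S. if \<alpha> i = 0 then 0 else of_nat (binom_mi (?down \<alpha>) \<beta>) * f \<alpha> * g \<beta>)
        + (\<Sum>(\<alpha>, \<beta>)\<in>S. if \<beta> i = 0 then 0 else of_nat (binom_mi \<alpha> (?down \<beta>)) * f \<alpha> * g \<beta>)"
      by (simp add: case_prod_unfold sum.distrib)
    also have "(\<Sum>(\<alpha>, \<beta>)\<in>S. if \<alpha> i = 0 then 0 else of_nat (binom_mi (?down \<alpha>) \<beta>) * f \<alpha> * g \<beta>)
        = (\<Sum>(\<alpha>, \<beta>)\<in>{x\<in>S. fst x i \<noteq> 0}. of_nat (binom_mi (?down \<alpha>) \<beta>) * f \<alpha> * g \<beta>)"
      by (rule sum.mono_neutral_cong_right) (use fin in \<open>auto split: if_splits\<close>)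
    also have "\<dots> = conv (delta i f) g \<gamma>"
      unfolding conv_def
      by (rule sum.reindex_bij_witness[where i = "\<lambda>(\<alpha>, \<beta>). (?up \<alpha>, \<beta>)" and j = "\<lambda>(\<alpha>, \<beta>). (?down \<alpha>, \<beta>)"])
        (auto simp: S_def splits_def delta_def fun_eq_iff split: if_splits)
    also have "(\<Sum>(\<alpha>, \<beta>)\<in>S. if \<beta> i = 0 then 0 else of_nat (binom_mi \<alpha> (?down \<beta>)) * f \<alpha> * g \<beta>)
        = (\<Sum>(\<alpha>, \<beta>)\<in>{x\<in>S. snd x i \<noteq> 0}. of_nat (binom_mi \<alpha> (?down \<beta>)) * f \<alpha> * g \<beta>)"
      by (rule sum.mono_neutral_cong_right) (use fin in \<open>auto split: if_splits\<close>)
    also have "\<dots> = conv f (delta i g) \<gamma>"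
      unfolding conv_def
      by (rule sum.reindex_bij_witness[where i = "\<lambda>(\<alpha>, \<beta>). (\<alpha>, ?up \<beta>)" and j = "\<lambda>(\<alpha>, \<beta>). (\<alpha>, ?down \<beta>)"])
        (auto simp: S_def splits_def delta_def fun_eq_iff split: if_splits)
    finally show ?thesis by (simp add: dadd_def)
  qed
qed

lemma derivation_ddelta: "derivation (ddelta i)"
  unfolding derivation_def
proof (intro conjI allI)
  fix x y :: "'a dalg"
  show "ddelta i (x + y) = ddelta i x + ddelta i y"
    by transfer (simp add: delta_def dadd_def)
  show "ddelta i (x * y) = ddelta i x * y + x * ddelta i y"
    by transfer (erule (1) Dn_common, rule delta_conv)
qed

text \<open>All \<open>ddelta i\<close> kill \<open>f ^ p\<close>, which is therefore the constant \<open>coef f 0 ^ p\<close>.\<close>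

lemma power_char_eq_0:
  fixes f :: "'a::field dalg"
  assumes "of_nat p = (0::'a dalg)" "p > 0" "coef f 0 = 0"
  shows "f ^ p = 0"
proof (rule dalg_eqI)
  fix \<alpha>
  show "coef (f ^ p) \<alpha> = coef 0 \<alpha>"
  proof (cases "\<alpha> = 0")
    case True
    then show ?thesis
      using assms by (simp add: coef_0_power zero_dalg.rep_eq dzero_def)
  next
    case False
    then obtain i where i: "\<alpha> i \<noteq> 0" by (auto simp: fun_eq_iff)
    have "ddelta i (f ^ p) = 0"
      using derivation_power[OF derivation_ddelta, of i f p] assms(1) by simp
    then have "coef (ddelta i (f ^ p)) (\<alpha>(i := \<alpha> i - 1)) = 0"
      by (simp add: zero_dalg.rep_eq dzero_def)
    then show ?thesis
      using i by (simp add: ddelta.rep_eq delta_def zero_dalg.rep_eq dzero_def)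
  qed
qed

lemma coef_ddelta_funpow: "coef ((ddelta i ^^ m) f) \<alpha> = coef f (\<alpha>(i := \<alpha> i + m))"
  by (induction m arbitrary: \<alpha>) (simp_all add: ddelta.rep_eq delta_def)

lemma coef_ddint_funpow:
  "coef ((ddint i ^^ m) f) \<alpha> = (if \<alpha> i < m then 0 else coef f (\<alpha>(i := \<alpha> i - m)))"
  by (induction m arbitrary: \<alpha>) (auto simp: ddint.rep_eq dint_def)

lemma ddelta_ddint_funpow: "(ddelta i ^^ m) ((ddint i ^^ m) f) = f"
  by (rule dalg_eqI) (simp add: coef_ddelta_funpow coef_ddint_funpow)

lemma ddelta_ddint_funpow_commute:
  "i \<noteq> j \<Longrightarrow> (ddelta j ^^ m) ((ddint i ^^ k) f) = (ddint i ^^ k) ((ddelta j ^^ m) f)"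
  by (rule dalg_eqI) (simp add: coef_ddelta_funpow coef_ddint_funpow fun_upd_twist)

lemma coef_delta_funpow: "(delta i ^^ m) (coef f) = coef ((ddelta i ^^ m) f)"
  by (induction m) (simp_all add: ddelta.rep_eq)

lemma coef_dint_funpow: "(dint i ^^ m) (coef f) = coef ((ddint i ^^ m) f)"
  by (induction m) (simp_all add: ddint.rep_eq)

subsection \<open>The subrings D_n\<close>

text \<open>\<open>dmul n\<close> is known to agree with the ring product on this subring, so
  membership is tracked wherever \<open>dmul\<close>, \<open>dpow\<close> or
  \<open>dprod_list\<close> is translated.\<close>

definition DN :: "nat \<Rightarrow> 'a::field dalg set" where
  "DN n = {f. coef f \<in> Dn n}"

lemma DN_1: "1 \<in> DN n"
  by (simp add: DN_def one_dalg.rep_eq dunit_Dn)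

lemma DN_add: "f \<in> DN n \<Longrightarrow> g \<in> DN n \<Longrightarrow> f + g \<in> DN n"
  by (simp add: DN_def plus_dalg.rep_eq dadd_Dn)

lemma DN_diff: "f \<in> DN n \<Longrightarrow> g \<in> DN n \<Longrightarrow> f - g \<in> DN n"
  by (simp add: DN_def minus_dalg.rep_eq dsub_eq dadd_Dn dscale_Dn)

lemma DN_mult: "f \<in> DN n \<Longrightarrow> g \<in> DN n \<Longrightarrow> f * g \<in> DN n"
  by (simp add: DN_def times_dalg.rep_eq conv_Dn)

lemma DN_const_mult: "f \<in> DN n \<Longrightarrow> const c * f \<in> DN n"
  by (simp add: DN_def coef_const_mult dscale_Dn)

lemma DN_power: "f \<in> DN n \<Longrightarrow> f ^ k \<in> DN n"
  by (induction k) (simp_all add: DN_1 DN_mult)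

lemma DN_prod: "(\<And>x. x \<in> A \<Longrightarrow> f x \<in> DN n) \<Longrightarrow> prod f A \<in> DN n"
  by (induction A rule: infinite_finite_induct) (simp_all add: DN_1 DN_mult)

lemma DN_ddint_funpow: "f \<in> DN n \<Longrightarrow> i < n \<Longrightarrow> (ddint i ^^ m) f \<in> DN n"
  by (induction m) (simp_all add: DN_def ddint.rep_eq dint_Dn)

lemma coef_Abs_dalg: "f \<in> Dn n \<Longrightarrow> coef (Abs_dalg f) = f"
  by (rule Abs_dalg_inverse) blast

lemma Abs_dalg_DN: "f \<in> Dn n \<Longrightarrow> Abs_dalg f \<in> DN n"
  by (simp add: DN_def coef_Abs_dalg)

lemma dmul_coef: "f \<in> DN n \<Longrightarrow> g \<in> DN n \<Longrightarrow> dmul n (coef f) (coef g) = coef (f * g)"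
  by (simp add: DN_def times_dalg.rep_eq conv_eq_dmul)

lemma dpow_coef: "f \<in> DN n \<Longrightarrow> dpow n (coef f) k = coef (f ^ k)"
  unfolding dpow_def
  by (induction k) (simp_all add: one_dalg.rep_eq dmul_coef DN_power)

lemma dprod_list_coef:
  "(\<And>x. x \<in> set xs \<Longrightarrow> f x \<in> DN n) \<Longrightarrow> dprod_list n (map (\<lambda>x. coef (f x)) xs) = coef (\<Prod>x\<leftarrow>xs. f x)
     \<and> (\<Prod>x\<leftarrow>xs. f x) \<in> DN n"
  unfolding dprod_list_def
  by (induction xs) (simp_all add: one_dalg.rep_eq dmul_coef DN_1 DN_mult)

lemma dprod_list_coef_upt:
  assumes "\<And>k. k < m \<Longrightarrow> f k \<in> DN n"
  shows "dprod_list n (map (\<lambda>k. coef (f k)) [0..<m]) = coef (\<Prod>k<m. f k)"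
  using dprod_list_coef[of "[0..<m]" f n] assms
  by (simp add: prod.distinct_set_conv_list[symmetric] atLeast0LessThan)

section \<open>The recursion defining the families y_u\<close>

lemma length_ypl: "length (ypl n p s u i k) = Suc k"
  by (induction k) simp_all

lemma ypl_nth: "l \<le> k \<Longrightarrow> ypl n p s u i k ! l = ypk n p s u i l"
  by (induction k) (auto simp: ypk_def nth_append length_ypl le_Suc_eq)

lemma ypl_eq_map: "ypl n p s u i k = map (ypk n p s u i) [0..<Suc k]"
  by (rule nth_equalityI) (simp_all add: length_ypl ypl_nth del: upt_Suc)

lemma dint_funpow_dunit: "(dint i ^^ m) dunit = (dpb (unit_mi i m) :: 'a::field dop)"
proof
  fix \<alpha>
  have "(\<alpha>(i := \<alpha> i - m) = zero_mi \<and> m \<le> \<alpha> i) \<longleftrightarrow> \<alpha> = unit_mi i m"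
    by (auto simp: zero_mi_def unit_mi_def fun_eq_iff)
  then show "(dint i ^^ m) dunit \<alpha> = (dpb (unit_mi i m) \<alpha> :: 'a)"
    using coef_dint_funpow[of m i "1 :: 'a dalg"]
    by (auto simp: one_dalg.rep_eq coef_ddint_funpow dunit_def dpb_def)
qed

text \<open>One recursion covering k = 0 as well: there the product is empty, and integrating 1 in
  variable i gives the basis element with index p^s e_i.\<close>

lemma ypk_rec:
  "ypk n p s u i k = dadd (u i k) ((dint i ^^ (p ^ s)) (dprod_list n
     (map (\<lambda>l. dscale (inverse (of_nat (fact (p - 1)))) (dpow n (ypk n p s u i l) (p - 1))) [0..<k])))"
proof (cases k)
  case 0
  then show ?thesis
    by (simp add: ypk_def dprod_list_def dint_funpow_dunit dadd_def add.commute)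
next
  case (Suc k')
  have "ypk n p s u i (Suc k') = dadd (u i (Suc k')) ((dint i ^^ (p ^ s)) (dprod_list n
      (map (\<lambda>y. dscale (inverse (of_nat (fact (p - 1)))) (dpow n y (p - 1))) (ypl n p s u i k'))))"
    by (simp add: ypk_def nth_append length_ypl)
  then show ?thesis
    by (simp add: Suc ypl_eq_map o_def del: upt_Suc)
qed

lemma deltas_unit_mi:
  "deltas p s m (unit_mi i 1) f = (if i < m then (delta i ^^ (p ^ s)) f else f)"
  by (induction m) (auto simp: unit_mi_def less_Suc_eq)

lemma mi_unit_mi: "i < n \<Longrightarrow> mi n (unit_mi i j)"
  by (simp add: mi_def unit_mi_def)

lemma unit_mi_add: "(\<lambda>l. unit_mi i a l + unit_mi i b l) = unit_mi i (a + b)"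
  by (auto simp: unit_mi_def)

lemma mbinom_unit_mi: "i < n \<Longrightarrow> mbinom n (unit_mi i a) (unit_mi i b) = a choose b"
proof -
  assume "i < n"
  then have "mbinom n (unit_mi i a) (unit_mi i b) = (\<Prod>l\<in>{i}. unit_mi i a l choose unit_mi i b l)"
    unfolding mbinom_def by (intro prod.mono_neutral_right) (auto simp: unit_mi_def)
  then show ?thesis by (simp add: unit_mi_def)
qed

lemma finite_Csn: "finite (Csn n p s)"
proof (rule finite_subset)
  show "Csn n p s \<subseteq> {f. \<forall>i. (i \<in> {..<n} \<longrightarrow> f i \<in> {..<p ^ s}) \<and> (i \<notin> {..<n} \<longrightarrow> f i = 0)}"
    by (auto simp: Csn_def mi_def)
qed (intro finite_set_of_finite_funs; simp)

lemma Mns_Dn: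
  assumes "u \<in> Mns n p s"
  shows "u i k \<in> Dn n"
proof (cases "i < n")
  case True
  then have "{\<alpha>. u i k \<alpha> \<noteq> 0} \<subseteq> Csn n p s"
    using assms by (auto simp: Mns_def)
  then show ?thesis
    using finite_subset[OF _ finite_Csn] by (auto simp: Dn_def Csn_def)
qed (use assms in \<open>simp add: Mns_def dzero_Dn\<close>)

section \<open>Operators over a field of characteristic p: the derivations \<open>\<Delta> i\<close>
  and integrations \<open>J i\<close>\<close>

locale char_p_field =
  fixes ty :: "'a::field itself" and p n s :: nat
  assumes CHAR: "CHAR('a) = p" and p_pos: "0 < p"
begin

definition ifact_const :: "nat \<Rightarrow> 'a dalg" where
  "ifact_const j = const (inverse (of_nat (fact j)))"

sublocale char_p_ring p ifact_const
proof
  show "prime p"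
    using CHAR p_pos prime_CHAR_semidom[where 'a = 'a] by simp
  then show "of_nat (fact j) * ifact_const j = 1" if "j < p" for j
  proof -
    have "\<not> p dvd fact j"
      using \<open>prime p\<close> that by (simp add: prime_dvd_fact_iff)
    then have "of_nat (fact j) \<noteq> (0::'a)"
      unfolding of_nat_eq_0_iff_char_dvd CHAR .
    then show ?thesis
      unfolding of_nat_dalg ifact_const_def const_mult[symmetric] by simp
  qed
  show "of_nat p = (0::'a dalg)"
    using of_nat_CHAR[where 'a = 'a] by (simp add: of_nat_dalg CHAR)
qed

abbreviation \<Delta> :: "nat \<Rightarrow> 'a dalg \<Rightarrow> 'a dalg" where
  "\<Delta> i \<equiv> ddelta i ^^ (p ^ s)"

abbreviation J :: "nat \<Rightarrow> 'a dalg \<Rightarrow> 'a dalg" where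
  "J i \<equiv> ddint i ^^ (p ^ s)"

lemma derivation_\<Delta>: "derivation (\<Delta> i)"
  by (intro derivation_funpow_prime_power derivation_ddelta)

lemma J_0 [simp]: "J i 0 = 0"
  by (rule dalg_eqI) (simp add: coef_ddint_funpow zero_dalg.rep_eq dzero_def)

lemma coef_J_0: "coef (J i f) 0 = 0"
  using p_pos by (simp add: coef_ddint_funpow)

lemma DN_divpow: "f \<in> DN n \<Longrightarrow> divpow f j \<in> DN n"
  by (simp add: divpow_def ifact_const_def DN_const_mult DN_power)

lemma DN_digit_prod: "(\<And>k. Y k \<in> DN n) \<Longrightarrow> digit_prod m Y j \<in> DN n"
  by (simp add: digit_prod_def DN_prod DN_divpow)

lemma dscale_dpow_coef:
  "f \<in> DN n \<Longrightarrow> dscale (inverse (of_nat (fact j))) (dpow n (coef f) j) = coef (divpow f j)"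
  by (simp add: dpow_coef divpow_def ifact_const_def coef_const_mult)

lemma derivation_divpow_eq_0:
  assumes "derivation d" "d y = 0" "j < p"
  shows "d (divpow y j) = 0"
  using assms by (simp add: divpow_def derivation_mult derivation_ifact derivation_power)

definition reduced :: "'a dalg \<Rightarrow> bool" where
  "reduced f \<longleftrightarrow> (\<forall>\<alpha>. coef f \<alpha> \<noteq> 0 \<longrightarrow> \<alpha> \<in> Csn n p s \<and> \<alpha> \<noteq> zero_mi)"

lemma reduced_coef_0: "reduced f \<Longrightarrow> coef f 0 = 0"
  by (auto simp: reduced_def zero_mi_eq_0)

text \<open>Raising one exponent by p^s leaves the box C_s^n, so \<open>\<Delta> i\<close> only
  reads off vanishing coefficients.\<close>

lemma reduced_\<Delta>: "reduced f \<Longrightarrow> \<Delta> i f = 0"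
proof (rule dalg_eqI)
  fix \<alpha> assume "reduced f"
  moreover have "\<alpha>(i := \<alpha> i + p ^ s) \<notin> Csn n p s"
    by (auto simp: Csn_def intro!: exI[of _ i])
  ultimately show "coef (\<Delta> i f) \<alpha> = coef 0 \<alpha>"
    by (auto simp: reduced_def coef_ddelta_funpow zero_dalg.rep_eq dzero_def)
qed

section \<open>Solutions of the recursion and their divided powers\<close>

definition yseq :: "(nat \<Rightarrow> 'a dalg) \<Rightarrow> nat \<Rightarrow> 'a dalg" where
  "yseq Y j = digit_prod (Suc j) Y j"

text \<open>The cut-off \<open>Suc j\<close> in \<open>yseq\<close> is the one in
  \<open>yij\<close>. It already covers all nonzero digits of j, so any other sufficient cut-off
  gives the same product.\<close>

lemma yseq_eq_digit_prod: "j < p ^ m \<Longrightarrow> yseq Y j = digit_prod m Y j"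
  unfolding yseq_def by (intro digit_prod_eq less_power_p_Suc)

lemma yseq_0 [simp]: "yseq Y 0 = 1"
  by (simp add: yseq_def)

lemma yseq_power_minus_one: "yseq Y (p ^ k - 1) = (\<Prod>l<k. divpow (Y l) (p - 1))"
  using p_pos by (simp add: yseq_eq_digit_prod[of _ k] digit_prod_power_minus_one[unfolded One_nat_def])

lemma digit_prod_power: "digit_prod (Suc k) Y (p ^ k) = Y k"
proof (induction k arbitrary: Y)
  case 0
  have "ifact_const 1 = 1"
    using fact_ifact[of 1] p_gt_1 by simp
  then show ?case
    using p_gt_1 by (simp add: digit_prod_Suc divpow_def)
next
  case (Suc k)
  have "digit_prod (Suc (Suc k)) Y (p ^ Suc k) = digit_prod (Suc k) (Y \<circ> Suc) (p ^ k)"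
    using p_pos by (subst digit_prod_Suc) simp
  then show ?case by (simp add: Suc)
qed

lemma yseq_power: "yseq Y (p ^ k) = Y k"
  using p_gt_1 by (simp add: yseq_eq_digit_prod[of _ "Suc k"] digit_prod_power)

lemma DN_yseq: "(\<And>k. Y k \<in> DN n) \<Longrightarrow> yseq Y j \<in> DN n"
  by (simp add: yseq_def DN_digit_prod)

text \<open>\<open>Y k\<close> stands for \<open>y\<^bsub>u,i\<^esub>\<^bsup>[p^k]\<^esup>\<close>; the element required to be reduced is \<open>u\<^sub>i\<^sub>k\<close>.\<close>

definition solution :: "nat \<Rightarrow> (nat \<Rightarrow> 'a dalg) \<Rightarrow> bool" where
  "solution i Y \<longleftrightarrow> (\<forall>k. Y k \<in> DN n \<and> reduced (Y k - J i (\<Prod>l<k. divpow (Y l) (p - 1))))"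

text \<open>Neither a reduced element nor an integral has a constant term, so
  \<open>power_char_eq_0\<close> applies.\<close>

lemma solution_nilpotent:
  assumes "solution i Y"
  shows "Y k ^ p = 0"
proof (rule power_char_eq_0)
  have "coef (Y k - J i (\<Prod>l<k. divpow (Y l) (p - 1))) 0 = 0"
    using assms by (auto simp: solution_def intro: reduced_coef_0)
  then show "coef (Y k) 0 = 0"
    by (simp add: minus_dalg.rep_eq dsub_def coef_J_0)
qed (auto simp: of_nat_p p_pos)

lemma solution_\<Delta>_split:
  assumes "solution i Y"
  shows "\<Delta> j (Y k) = \<Delta> j (J i (\<Prod>l<k. divpow (Y l) (p - 1)))"
proof -
  let ?P = "J i (\<Prod>l<k. divpow (Y l) (p - 1))"
  have "\<Delta> j (Y k - ?P) = 0"
    using assms by (simp add: solution_def reduced_\<Delta>)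
  moreover have "\<Delta> j (Y k) = \<Delta> j (Y k - ?P) + \<Delta> j ?P"
    using derivation_add[OF derivation_\<Delta>, of j "Y k - ?P" ?P] by simp
  ultimately show ?thesis by simp
qed

text \<open>\<open>\<Delta> i\<close> kills the reduced part and undoes \<open>J i\<close>, which is
  the hypothesis of \<open>derivation_digit_prod\<close> with c = 1.\<close>

lemma solution_\<Delta>_same:
  assumes "solution i Y"
  shows "\<Delta> i (yseq Y j) = (if j = 0 then 0 else yseq Y (j - 1))"
proof (cases "j = 0")
  case True
  then show ?thesis by (simp add: derivation_1[OF derivation_\<Delta>])
next
  case False
  have "\<Delta> i (Y k) = 1 * (\<Prod>l<k. divpow (Y l) (p - 1))" for k
    using solution_\<Delta>_split[OF assms, of i k] by (simp add: ddelta_ddint_funpow)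
  then have "\<Delta> i (digit_prod j Y j) = 1 * digit_prod j Y (j - 1)"
    using False less_power_p solution_nilpotent[OF assms]
    by (intro derivation_digit_prod[OF derivation_\<Delta>]) auto
  moreover have "j - 1 < p ^ j" using less_power_p[of j] by linarith
  ultimately show ?thesis
    using False less_power_p by (simp add: yseq_eq_digit_prod[of _ j])
qed

text \<open>\<open>\<Delta> l\<close> commutes with \<open>J i\<close>, so by strong induction on k
  it kills the product of earlier members, its integral, and hence \<open>Y k\<close>.\<close>

lemma solution_\<Delta>_other:
  assumes "solution i Y" "i \<noteq> l"
  shows "\<Delta> l (yseq Y j) = 0"
proof -
  have Y: "\<Delta> l (Y k) = 0" for k
  proof (induction k rule: less_induct)
    case (less k)
    \<comment> \<open>The l bound by the product is unrelated to the index l of the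
      derivation.\<close>
    have "\<Delta> l (\<Prod>l<k. divpow (Y l) (p - 1)) = 0"
      using less p_pos
      by (intro derivation_prod_eq_0[OF derivation_\<Delta>] derivation_divpow_eq_0[OF derivation_\<Delta>]) auto
    then show ?case
      unfolding solution_\<Delta>_split[OF assms(1)] ddelta_ddint_funpow_commute[OF assms(2)] by simp
  qed
  show ?thesis
    unfolding yseq_def digit_prod_def using Y p_pos
    by (intro derivation_prod_eq_0[OF derivation_\<Delta>] derivation_divpow_eq_0[OF derivation_\<Delta>]) auto
qed

lemma solution_divided_powers:
  assumes "solution i Y"
  shows "divided_powers (yseq Y)"
  unfolding divided_powers_def
proof (intro conjI allI)
  fix a b
  have "a + b < p ^ (a + b)" by (rule less_power_p)
  moreover from this have "a < p ^ (a + b)" "b < p ^ (a + b)" by linarith+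
  ultimately show "yseq Y a * yseq Y b = of_nat ((a + b) choose b) * yseq Y (a + b)"
    using digit_prod_mult[of Y a b "a + b"] solution_nilpotent[OF assms]
    by (simp add: yseq_eq_digit_prod[of _ "a + b"])
qed simp

lemma \<Delta>_funpow_yseq:
  assumes "solution i Y"
  shows "(\<Delta> i ^^ a) (yseq Y j) = (if a \<le> j then yseq Y (j - a) else 0)"
proof (induction a)
  case (Suc a)
  then show ?case
    by (auto simp: solution_\<Delta>_same[OF assms] derivation_0[OF derivation_\<Delta>]
        derivation_1[OF derivation_\<Delta>])
qed simp

lemma \<Delta>_funpow_mult:
  assumes "\<Delta> i r = 0"
  shows "(\<Delta> i ^^ a) (x * r) = (\<Delta> i ^^ a) x * r"
  by (induction a) (simp_all add: derivation_mult[OF derivation_\<Delta>] assms)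

text \<open>The factors with index other than m are constants for \<open>\<Delta> m\<close>; they
  are collected in \<open>R\<close>.\<close>

lemma \<Delta>_funpow_prod:
  assumes "\<And>i. i < n \<Longrightarrow> solution i (Y i)" "m < n"
  shows "(\<Delta> m ^^ a) (\<Prod>i<n. yseq (Y i) (\<gamma> i))
    = (if a \<le> \<gamma> m then (\<Prod>i<n. yseq (Y i) ((\<gamma>(m := \<gamma> m - a)) i)) else 0)"
proof -
  define R where "R = (\<Prod>i\<in>{..<n} - {m}. yseq (Y i) (\<gamma> i))"
  have split: "(\<Prod>i<n. yseq (Y i) (\<gamma>' i)) = yseq (Y m) (\<gamma>' m) * R"
    if "\<And>i. i \<noteq> m \<Longrightarrow> \<gamma>' i = \<gamma> i" for \<gamma>'
  proof -
    have "(\<Prod>i<n. yseq (Y i) (\<gamma>' i)) = yseq (Y m) (\<gamma>' m) * (\<Prod>i\<in>{..<n} - {m}. yseq (Y i) (\<gamma>' i))"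
      using assms(2) by (intro prod.remove) auto
    also have "(\<Prod>i\<in>{..<n} - {m}. yseq (Y i) (\<gamma>' i)) = R"
      unfolding R_def using that by (intro prod.cong) auto
    finally show ?thesis .
  qed
  have "\<Delta> m R = 0"
    unfolding R_def using assms
    by (intro derivation_prod_eq_0[OF derivation_\<Delta>] solution_\<Delta>_other) auto
  then show ?thesis
    using assms by (simp add: split \<Delta>_funpow_mult \<Delta>_funpow_yseq)
qed

text \<open>The induction applies one variable at a time: after m steps exactly the exponents below
  m have been lowered, and the result stays 0 once some \<alpha>_i exceeds \<beta>_i.\<close>

lemma deltas_prod:
  assumes "\<And>i. i < n \<Longrightarrow> solution i (Y i)" "m \<le> n"
  shows "deltas p s m \<alpha> (coef (\<Prod>i<n. yseq (Y i) (\<beta> i)))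
    = (if \<forall>i<m. \<alpha> i \<le> \<beta> i then coef (\<Prod>i<n. yseq (Y i) (if i < m then \<beta> i - \<alpha> i else \<beta> i)) else dzero)"
  using assms(2)
proof (induction m)
  case (Suc m)
  have coef: "((delta m ^^ p ^ s) ^^ a) (coef f) = coef ((\<Delta> m ^^ a) f)" for a and f :: "'a dalg"
    by (simp add: funpow_mult coef_delta_funpow)
  show ?case
  proof (cases "\<forall>i<m. \<alpha> i \<le> \<beta> i")
    case True
    define \<gamma> where "\<gamma> i = (if i < m then \<beta> i - \<alpha> i else \<beta> i)" for i
    have "(\<gamma>(m := \<gamma> m - \<alpha> m)) i = (if i < Suc m then \<beta> i - \<alpha> i else \<beta> i)" for i
      by (auto simp: \<gamma>_def)
    moreover have "deltas p s (Suc m) \<alpha> (coef (\<Prod>i<n. yseq (Y i) (\<beta> i)))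
        = coef ((\<Delta> m ^^ \<alpha> m) (\<Prod>i<n. yseq (Y i) (\<gamma> i)))"
      using Suc True by (simp add: coef \<gamma>_def)
    moreover have "\<gamma> m = \<beta> m" by (simp add: \<gamma>_def)
    ultimately show ?thesis
      using True Suc.prems \<Delta>_funpow_prod[OF assms(1), of m "\<alpha> m" \<gamma>]
      by (simp add: less_Suc_eq zero_dalg.rep_eq del: fun_upd_apply)
  next
    case False
    have "((delta m ^^ p ^ s) ^^ \<alpha> m) dzero = coef ((\<Delta> m ^^ \<alpha> m) (0 :: 'a dalg))"
      using coef[of "\<alpha> m" 0] by (simp add: zero_dalg.rep_eq)
    also have "(\<Delta> m ^^ a) 0 = (0 :: 'a dalg)" for a
      by (induction a) (simp_all add: derivation_0[OF derivation_\<Delta>])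
    finally show ?thesis
      using False Suc by (auto simp: zero_dalg.rep_eq less_Suc_eq)
  qed
qed simp

section \<open>The families y_u as members of ID\<close>

definition Yseq :: "(nat \<Rightarrow> nat \<Rightarrow> 'a dop) \<Rightarrow> nat \<Rightarrow> nat \<Rightarrow> 'a dalg" where
  "Yseq u i k = Abs_dalg (ypk n p s u i k)"

text \<open>Both claims are proved in one strong induction: the list products can be read in the
  ring only once all earlier members are known to lie in D_n.\<close>

lemma Yseq_props:
  assumes u: "u \<in> Mns n p s" and i: "i < n"
  shows "ypk n p s u i k \<in> Dn n \<and> Yseq u i k = Abs_dalg (u i k) + J i (\<Prod>l<k. divpow (Yseq u i l) (p - 1))"
proof (induction k rule: less_induct)
  case (less k)
  then have Dn: "ypk n p s u i l \<in> Dn n" if "l < k" for l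
    using that by blast
  have Y: "Yseq u i l \<in> DN n" "ypk n p s u i l = coef (Yseq u i l)" if "l < k" for l
    using Abs_dalg_DN[OF Dn[OF that]] coef_Abs_dalg[OF Dn[OF that]] by (simp_all add: Yseq_def)
  have map: "map (\<lambda>l. dscale (inverse (of_nat (fact (p - 1)))) (dpow n (ypk n p s u i l) (p - 1))) [0..<k]
      = map (\<lambda>l. coef (divpow (Yseq u i l) (p - 1))) [0..<k]"
    using Y by (simp add: dscale_dpow_coef)
  have "ypk n p s u i k = dadd (u i k) ((dint i ^^ (p ^ s)) (coef (\<Prod>l<k. divpow (Yseq u i l) (p - 1))))"
    by (subst ypk_rec) (simp only: map dprod_list_coef_upt[OF DN_divpow[OF Y(1)]])
  also have "\<dots> = coef (Abs_dalg (u i k) + J i (\<Prod>l<k. divpow (Yseq u i l) (p - 1)))"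
    by (simp add: plus_dalg.rep_eq coef_dint_funpow coef_Abs_dalg[OF Mns_Dn[OF u]])
  finally have *: "ypk n p s u i k = coef (Abs_dalg (u i k) + J i (\<Prod>l<k. divpow (Yseq u i l) (p - 1)))" .
  have "Abs_dalg (u i k) + J i (\<Prod>l<k. divpow (Yseq u i l) (p - 1)) \<in> DN n"
    using Y i by (intro DN_add DN_ddint_funpow DN_prod DN_divpow Abs_dalg_DN Mns_Dn[OF u]) auto
  then show ?case
    using * by (simp add: Yseq_def[of u i k] coef_inverse DN_def)
qed

lemma coef_Yseq: "u \<in> Mns n p s \<Longrightarrow> i < n \<Longrightarrow> coef (Yseq u i k) = ypk n p s u i k"
  unfolding Yseq_def by (rule coef_Abs_dalg) (rule conjunct1[OF Yseq_props])

lemma Yseq_DN: "u \<in> Mns n p s \<Longrightarrow> i < n \<Longrightarrow> Yseq u i k \<in> DN n"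
  unfolding Yseq_def by (rule Abs_dalg_DN) (rule conjunct1[OF Yseq_props])

lemma solution_Yseq:
  assumes "u \<in> Mns n p s" "i < n"
  shows "solution i (Yseq u i)"
  unfolding solution_def
proof (intro allI conjI)
  fix k
  show "Yseq u i k \<in> DN n" by (rule Yseq_DN[OF assms])
  have "Yseq u i k - J i (\<Prod>l<k. divpow (Yseq u i l) (p - 1)) = Abs_dalg (u i k)"
    using Yseq_props[OF assms, of k] by (simp add: algebra_simps)
  moreover have "reduced (Abs_dalg (u i k))"
    using assms by (simp add: reduced_def coef_Abs_dalg[OF Mns_Dn[OF assms(1)]] Mns_def)
  ultimately show "reduced (Yseq u i k - J i (\<Prod>l<k. divpow (Yseq u i l) (p - 1)))" by simp
qed

lemma yij_eq:
  assumes "u \<in> Mns n p s" "i < n"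
  shows "yij n p s u i j = coef (yseq (Yseq u i) j)"
proof (cases "j = 0")
  case True
  then show ?thesis by (simp add: yij_def one_dalg.rep_eq)
next
  case False
  have "yij n p s u i j = dprod_list n (map (\<lambda>k. coef (divpow (Yseq u i k) (j div p ^ k mod p))) [0..<Suc j])"
    using False by (simp add: yij_def Let_def dscale_dpow_coef[OF Yseq_DN[OF assms]] coef_Yseq[OF assms, symmetric] del: upt_Suc)
  also have "\<dots> = coef (yseq (Yseq u i) j)"
    unfolding yseq_def digit_prod_def
    by (rule dprod_list_coef_upt) (simp add: DN_divpow Yseq_DN[OF assms])
  finally show ?thesis .
qed

lemma yfam_eq:
  assumes "u \<in> Mns n p s" "mi n \<alpha>"
  shows "yfam n p s u \<alpha> = coef (\<Prod>i<n. yseq (Yseq u i) (\<alpha> i))"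
proof -
  have "yfam n p s u \<alpha> = dprod_list n (map (\<lambda>i. coef (yseq (Yseq u i) (\<alpha> i))) [0..<n])"
    using assms by (auto simp: yfam_def yij_eq intro!: arg_cong[of _ _ "dprod_list n"])
  also have "\<dots> = coef (\<Prod>i<n. yseq (Yseq u i) (\<alpha> i))"
    by (rule dprod_list_coef_upt) (simp add: DN_yseq Yseq_DN[OF assms(1)])
  finally show ?thesis .
qed

lemma yfam_in_ID:
  fixes u :: "nat \<Rightarrow> nat \<Rightarrow> 'a dop"
  assumes u: "u \<in> Mns n p s"
  shows "yfam n p s u \<in> ID n p s"
proof -
  define F where "F \<alpha> = (\<Prod>i<n. yseq (Yseq u i) (\<alpha> i))" for \<alpha>
  have F: "yfam n p s u \<alpha> = coef (F \<alpha>)" if "mi n \<alpha>" for \<alpha>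
    using yfam_eq[OF u that] by (simp add: F_def)
  have DN: "F \<alpha> \<in> DN n" for \<alpha>
    unfolding F_def by (intro DN_prod DN_yseq Yseq_DN[OF u]) auto
  have mult: "F \<alpha> * F \<beta> = of_nat (mbinom n (\<lambda>i. \<alpha> i + \<beta> i) \<beta>) * F (\<lambda>i. \<alpha> i + \<beta> i)" for \<alpha> \<beta>
  proof -
    have "F \<alpha> * F \<beta> = (\<Prod>i<n. of_nat ((\<alpha> i + \<beta> i) choose \<beta> i) * yseq (Yseq u i) (\<alpha> i + \<beta> i))"
      unfolding F_def prod.distrib[symmetric]
      using solution_divided_powers[OF solution_Yseq[OF u]]
      by (intro prod.cong) (auto simp: divided_powers_def)
    then show ?thesis
      by (simp add: F_def mbinom_def prod.distrib)
  qed
  show ?thesis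
    unfolding ID_def
  proof (intro CollectI conjI allI impI)
    fix \<alpha> \<beta> :: "nat \<Rightarrow> nat"
    assume \<alpha>\<beta>: "mi n \<alpha>" "mi n \<beta>"
    then have add: "mi n (\<lambda>i. \<alpha> i + \<beta> i)" by (simp add: mi_def)
    show "dmul n (yfam n p s u \<alpha>) (yfam n p s u \<beta>)
        = dscale (of_nat (mbinom n (\<lambda>i. \<alpha> i + \<beta> i) \<beta>)) (yfam n p s u (\<lambda>i. \<alpha> i + \<beta> i))"
      by (simp add: F \<alpha>\<beta> add dmul_coef[OF DN DN] mult of_nat_dalg coef_const_mult)
    have sub: "mi n (\<lambda>i. \<beta> i - \<alpha> i)" using \<alpha>\<beta> by (simp add: mi_def)
    have all: "(\<forall>i<n. \<alpha> i \<le> \<beta> i) \<longleftrightarrow> (\<forall>i. \<alpha> i \<le> \<beta> i)"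
      using \<alpha>\<beta>(1) by (metis mi_def linorder_not_less le0)
    have "(\<Prod>i<n. yseq (Yseq u i) (if i < n then \<beta> i - \<alpha> i else \<beta> i)) = F (\<lambda>i. \<beta> i - \<alpha> i)"
      by (simp add: F_def)
    then show "deltas p s n \<alpha> (yfam n p s u \<beta>)
        = (if \<forall>i. \<alpha> i \<le> \<beta> i then yfam n p s u (\<lambda>i. \<beta> i - \<alpha> i) else dzero)"
      using deltas_prod[of "Yseq u" n \<alpha> \<beta>, OF solution_Yseq[OF u]]
      unfolding all F[OF \<alpha>\<beta>(2)] F[OF sub] by (simp add: F_def)
  next
    show "yfam n p s u \<alpha> \<in> Dn n" if "mi n \<alpha>" for \<alpha>
      using DN F[OF that] by (simp add: DN_def)
    show "yfam n p s u \<alpha> = dzero" if "\<not> mi n \<alpha>" for \<alpha>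
      using that by (simp add: yfam_def)
    have "mi n zero_mi" by (simp add: mi_def zero_mi_def)
    then show "yfam n p s u zero_mi = dunit"
      by (simp add: F F_def zero_mi_def one_dalg.rep_eq)
  qed
qed

lemma yfam_unit_mi:
  assumes "u \<in> Mns n p s" "i < n"
  shows "yfam n p s u (unit_mi i j) = coef (yseq (Yseq u i) j)"
proof -
  have "(\<Prod>l<n. yseq (Yseq u l) (unit_mi i j l)) = (\<Prod>l\<in>{i}. yseq (Yseq u l) (unit_mi i j l))"
    by (rule prod.mono_neutral_right) (use assms(2) in \<open>auto simp: unit_mi_def\<close>)
  then show ?thesis
    using yfam_eq[OF assms(1) mi_unit_mi[OF assms(2)]] by (simp add: unit_mi_def)
qed

text \<open>The member at p^k - 1 is the product inside the recursion, so \<open>uinv\<close> just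
  solves the recursion for u_ik.\<close>

lemma uinv_yfam:
  fixes u :: "nat \<Rightarrow> nat \<Rightarrow> 'a dop"
  assumes u: "u \<in> Mns n p s"
  shows "uinv n p s (yfam n p s u) = u"
proof (intro ext)
  fix i k \<alpha>
  show "uinv n p s (yfam n p s u) i k \<alpha> = u i k \<alpha>"
  proof (cases "i < n")
    case True
    have "uinv n p s (yfam n p s u) i k = coef (Yseq u i k - J i (\<Prod>l<k. divpow (Yseq u i l) (p - 1)))"
      using True by (simp add: uinv_def yfam_unit_mi[OF u True] coef_dint_funpow yseq_power
          yseq_power_minus_one[unfolded One_nat_def] minus_dalg.rep_eq)
    also have "\<dots> = coef (Abs_dalg (u i k))"
      using Yseq_props[OF u True, of k] by (simp add: algebra_simps)
    finally show ?thesis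
      by (simp add: coef_Abs_dalg[OF Mns_Dn[OF u]])
  next
    case False
    then show ?thesis using u by (simp add: uinv_def Mns_def)
  qed
qed

section \<open>From a family in ID back to its matrix\<close>

context
  fixes z :: "(nat \<Rightarrow> nat) \<Rightarrow> 'a dop"
  assumes z: "z \<in> ID n p s"
begin

definition Z :: "(nat \<Rightarrow> nat) \<Rightarrow> 'a dalg" where
  "Z \<alpha> = Abs_dalg (z \<alpha>)"

lemma coef_Z: "mi n \<alpha> \<Longrightarrow> coef (Z \<alpha>) = z \<alpha>"
  unfolding Z_def using z by (intro coef_Abs_dalg[of _ n]) (auto simp: ID_def)

lemma Z_DN: "mi n \<alpha> \<Longrightarrow> Z \<alpha> \<in> DN n"
  unfolding Z_def using z by (intro Abs_dalg_DN) (auto simp: ID_def)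

lemma Z_0: "Z zero_mi = 1"
  using z by (simp add: Z_def ID_def one_dalg_def)

lemma Z_mult:
  assumes "mi n \<alpha>" "mi n \<beta>"
  shows "Z \<alpha> * Z \<beta> = of_nat (mbinom n (\<lambda>i. \<alpha> i + \<beta> i) \<beta>) * Z (\<lambda>i. \<alpha> i + \<beta> i)"
proof -
  have "mi n (\<lambda>i. \<alpha> i + \<beta> i)" using assms by (simp add: mi_def)
  moreover have "dmul n (z \<alpha>) (z \<beta>) = dscale (of_nat (mbinom n (\<lambda>i. \<alpha> i + \<beta> i) \<beta>)) (z (\<lambda>i. \<alpha> i + \<beta> i))"
    using z assms by (auto simp: ID_def)
  ultimately have "coef (Z \<alpha> * Z \<beta>) = coef (of_nat (mbinom n (\<lambda>i. \<alpha> i + \<beta> i) \<beta>) * Z (\<lambda>i. \<alpha> i + \<beta> i))"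
    using dmul_coef[OF Z_DN[OF assms(1)] Z_DN[OF assms(2)]] assms
    by (simp add: coef_Z of_nat_dalg coef_const_mult)
  then show ?thesis by (simp add: coef_inject)
qed

lemma Z_unit_mi_divided_powers:
  assumes "i < n"
  shows "divided_powers (\<lambda>j. Z (unit_mi i j))"
  unfolding divided_powers_def
proof (intro conjI allI)
  have "unit_mi i 0 = zero_mi" by (auto simp: unit_mi_def zero_mi_def)
  then show "Z (unit_mi i 0) = 1" by (simp add: Z_0)
  fix a b
  show "Z (unit_mi i a) * Z (unit_mi i b) = of_nat (a + b choose b) * Z (unit_mi i (a + b))"
    using Z_mult[OF mi_unit_mi[OF assms] mi_unit_mi[OF assms], of a b]
    by (simp add: unit_mi_add mbinom_unit_mi assms)
qed

text \<open>The derivation axiom of \<open>ID\<close> with \<alpha> = e_l and \<beta> = j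
  e_i.\<close>

lemma \<Delta>_Z_unit_mi:
  assumes "i < n" "l < n"
  shows "\<Delta> l (Z (unit_mi i j)) = (if l = i \<and> j \<noteq> 0 then Z (unit_mi i (j - 1)) else 0)"
proof -
  have le: "(\<forall>m. unit_mi l 1 m \<le> unit_mi i j m) \<longleftrightarrow> l = i \<and> j \<noteq> 0"
    by (auto simp: unit_mi_def split: if_splits)
  have "coef (\<Delta> l (Z (unit_mi i j))) = deltas p s n (unit_mi l 1) (z (unit_mi i j))"
    using assms by (simp only: deltas_unit_mi coef_delta_funpow[symmetric] coef_Z mi_unit_mi if_True)
  also have "\<dots> = (if l = i \<and> j \<noteq> 0 then z (\<lambda>m. unit_mi i j m - unit_mi l 1 m) else dzero)"
  proof -
    have "\<forall>\<alpha> \<beta>. mi n \<alpha> \<longrightarrow> mi n \<beta> \<longrightarrow> deltas p s n \<alpha> (z \<beta>)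
        = (if \<forall>i. \<alpha> i \<le> \<beta> i then z (\<lambda>i. \<beta> i - \<alpha> i) else dzero)"
      using z by (simp add: ID_def)
    then show ?thesis
      using mi_unit_mi[OF assms(1)] mi_unit_mi[OF assms(2)] unfolding le[symmetric] by simp
  qed
  also have "\<dots> = (if l = i \<and> j \<noteq> 0 then z (unit_mi i (j - 1)) else dzero)"
  proof -
    have "(\<lambda>m. unit_mi i j m - unit_mi i 1 m) = unit_mi i (j - 1)"
      by (auto simp: unit_mi_def)
    then show ?thesis by simp
  qed
  also have "\<dots> = coef (if l = i \<and> j \<noteq> 0 then Z (unit_mi i (j - 1)) else 0)"
    by (simp add: coef_Z mi_unit_mi[OF assms(1)] zero_dalg.rep_eq)
  finally show ?thesis by (simp add: coef_inject)
qed

text \<open>Coordinates are multiplied in one at a time. The indices have disjoint supports, so the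
  binomial is 1; thus z is determined by its members at multiples of the e_i.\<close>

lemma Z_eq_prod:
  assumes "mi n \<alpha>"
  shows "Z \<alpha> = (\<Prod>i<n. Z (unit_mi i (\<alpha> i)))"
proof -
  have "Z (\<lambda>i. if i < m then \<alpha> i else 0) = (\<Prod>i<m. Z (unit_mi i (\<alpha> i)))" if "m \<le> n" for m
    using that
  proof (induction m)
    case 0
    then show ?case using Z_0 by (simp add: zero_mi_def)
  next
    case (Suc m)
    let ?\<beta> = "\<lambda>i. if i < m then \<alpha> i else 0"
    have "(\<lambda>i. ?\<beta> i + unit_mi m (\<alpha> m) i) = (\<lambda>i. if i < Suc m then \<alpha> i else 0)"
      by (auto simp: unit_mi_def fun_eq_iff)
    moreover have "mbinom n (\<lambda>i. ?\<beta> i + unit_mi m (\<alpha> m) i) (unit_mi m (\<alpha> m)) = 1"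
      unfolding mbinom_def by (rule prod.neutral) (auto simp: unit_mi_def)
    moreover have "mi n ?\<beta>" "mi n (unit_mi m (\<alpha> m))"
      using Suc.prems by (auto simp: mi_def unit_mi_def)
    ultimately have "Z ?\<beta> * Z (unit_mi m (\<alpha> m)) = Z (\<lambda>i. if i < Suc m then \<alpha> i else 0)"
      using Z_mult[of ?\<beta> "unit_mi m (\<alpha> m)"] by simp
    then show ?case using Suc by simp
  qed
  moreover have "(\<lambda>i. if i < n then \<alpha> i else 0) = \<alpha>"
    using assms by (auto simp: mi_def)
  ultimately show ?thesis by fastforce
qed

lemma uinv_eq_coef:
  assumes "i < n"
  shows "uinv n p s z i k = coef (Z (unit_mi i (p ^ k)) - J i (Z (unit_mi i (p ^ k - 1))))"
  using assms by (simp add: uinv_def minus_dalg.rep_eq coef_Z mi_unit_mi flip: coef_dint_funpow)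

text \<open>The operator is nilpotent, so its constant term is a nilpotent element of a
  field.\<close>

lemma coef_0_Z: "i < n \<Longrightarrow> coef (Z (unit_mi i (p ^ k))) 0 = 0"
  using divided_powers_nilpotent[OF Z_unit_mi_divided_powers, of i k]
    coef_0_power[of "Z (unit_mi i (p ^ k))" p]
  by (simp add: zero_dalg.rep_eq dzero_def)

lemma uinv_in_Mns: "uinv n p s z \<in> Mns n p s"
  unfolding Mns_def
proof (intro CollectI conjI allI impI)
  fix i k \<alpha>
  assume i: "i < n" and nz: "uinv n p s z i k \<alpha> \<noteq> 0"
  define W where "W = Z (unit_mi i (p ^ k)) - J i (Z (unit_mi i (p ^ k - 1)))"
  have W: "coef W \<alpha> \<noteq> 0" using nz by (simp add: W_def uinv_eq_coef[OF i])
  have sum: "Z (unit_mi i (p ^ k)) = W + J i (Z (unit_mi i (p ^ k - 1)))"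
    by (simp add: W_def)
  have \<Delta>W: "\<Delta> l W = 0" if "l < n" for l
  proof -
    \<comment> \<open>For l = i both sides are the member at p^k - 1. For other l both vanish, the
      right one because \<open>\<Delta> l\<close> passes through \<open>J i\<close>.\<close>
    have "\<Delta> l (Z (unit_mi i (p ^ k))) = \<Delta> l (J i (Z (unit_mi i (p ^ k - 1))))"
    proof (cases "l = i")
      case True
      then show ?thesis
        using p_pos i by (simp add: \<Delta>_Z_unit_mi ddelta_ddint_funpow)
    next
      case False
      then show ?thesis
        using i that by (simp add: \<Delta>_Z_unit_mi ddelta_ddint_funpow_commute)
    qed
    then show ?thesis
      using derivation_add[OF derivation_\<Delta>, of l W "J i (Z (unit_mi i (p ^ k - 1)))"] sum by simp
  qed
  have "W \<in> DN n"
    unfolding W_def using i by (intro DN_diff DN_ddint_funpow Z_DN mi_unit_mi) auto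
  then have mi: "mi n \<alpha>" using W by (auto simp: DN_def Dn_def)
  have "\<alpha> l < p ^ s" for l
  proof (cases "l < n")
    case True
    show ?thesis
    proof (rule ccontr)
      assume "\<not> \<alpha> l < p ^ s"
      \<comment> \<open>A coefficient of \<open>W\<close> with \<alpha>_l at least p^s reappears in
        \<open>\<Delta> l W\<close>, which is 0.\<close>
      then have "coef (\<Delta> l W) (\<alpha>(l := \<alpha> l - p ^ s)) = coef W \<alpha>"
        by (simp add: coef_ddelta_funpow)
      then show False using W \<Delta>W[OF True] by (simp add: zero_dalg.rep_eq dzero_def)
    qed
  next
    case False
    then show ?thesis using mi p_pos by (simp add: mi_def)
  qed
  then show "\<alpha> \<in> Csn n p s" using mi by (simp add: Csn_def)
  have "coef W 0 = 0"
    by (simp add: W_def minus_dalg.rep_eq dsub_def coef_J_0 coef_0_Z[OF i])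
  then show "\<alpha> \<noteq> zero_mi" using W by (auto simp: zero_mi_eq_0)
next
  fix i k assume "n \<le> i"
  then show "uinv n p s z i k = dzero" by (simp add: uinv_def)
qed

text \<open>It suffices to recover the members at p^k in each direction i: digit products then give
  all multiples of e_i, and \<open>Z_eq_prod\<close> the whole family.\<close>

lemma yfam_uinv: "yfam n p s (uinv n p s z) = z"
proof
  fix \<alpha>
  let ?u = "uinv n p s z"
  have u: "?u \<in> Mns n p s" by (rule uinv_in_Mns)
  show "yfam n p s ?u \<alpha> = z \<alpha>"
  proof (cases "mi n \<alpha>")
    case True
    have Z: "Z (unit_mi i j) = yseq (\<lambda>k. Z (unit_mi i (p ^ k))) j" if "i < n" for i j
      unfolding yseq_def
      by (intro divided_powers_eq_digit_prod[OF Z_unit_mi_divided_powers[OF that]] less_power_p_Suc)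
    have Y: "Yseq ?u i k = Z (unit_mi i (p ^ k))" if i: "i < n" for i k
    proof (induction k rule: less_induct)
      case (less k)
      have "Yseq ?u i k = Abs_dalg (?u i k) + J i (\<Prod>l<k. divpow (Yseq ?u i l) (p - 1))"
        using Yseq_props[OF u i] by blast
      also have "(\<Prod>l<k. divpow (Yseq ?u i l) (p - 1)) = (\<Prod>l<k. divpow (Z (unit_mi i (p ^ l))) (p - 1))"
        using less by (intro prod.cong) auto
      \<comment> \<open>The earlier members already agree with z, so the product is the digit
        expansion of the member at p^k - 1; adding u_ik to its integral restores the member at
        p^k.\<close>
      also have "\<dots> = Z (unit_mi i (p ^ k - 1))"
        unfolding Z[OF i, of "p ^ k - 1"] by (rule yseq_power_minus_one[symmetric])
      also have "Abs_dalg (?u i k) = Z (unit_mi i (p ^ k)) - J i (Z (unit_mi i (p ^ k - 1)))"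
        by (simp add: uinv_eq_coef[OF i] coef_inverse)
      finally show ?case by simp
    qed
    have "(\<Prod>i<n. yseq (Yseq ?u i) (\<alpha> i)) = (\<Prod>i<n. Z (unit_mi i (\<alpha> i)))"
    proof (rule prod.cong[OF refl])
      fix i assume "i \<in> {..<n}"
      then show "yseq (Yseq ?u i) (\<alpha> i) = Z (unit_mi i (\<alpha> i))"
        using Y Z[of i "\<alpha> i"] by (simp add: yseq_def digit_prod_def)
    qed
    then show ?thesis
      using yfam_eq[OF u True] Z_eq_prod[OF True] coef_Z[OF True] by simp
  next
    case False
    then show ?thesis using z by (auto simp: yfam_def ID_def)
  qed
qed

end

end

section \<open>Bijectivity and the formula for the inverse\<close>

theorem theorem5p1:
  fixes n p s :: nat
  assumes "CHAR('a::field) = p" and "0 < p" and "1 \<le> s"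
  shows "bij_betw (yfam n p s :: (nat \<Rightarrow> nat \<Rightarrow> 'a dop) \<Rightarrow> _) (Mns n p s) (ID n p s)
     \<and> (\<forall>z \<in> ID n p s. inv_into (Mns n p s) (yfam n p s) z = (uinv n p s z :: nat \<Rightarrow> nat \<Rightarrow> 'a dop))"
proof -
  interpret char_p_field "TYPE('a)" p n s
    by standard (use assms in simp_all)
  have bij: "bij_betw (yfam n p s :: (nat \<Rightarrow> nat \<Rightarrow> 'a dop) \<Rightarrow> _) (Mns n p s) (ID n p s)"
    by (rule bij_betw_byWitness[where f' = "uinv n p s"])
      (auto simp: uinv_yfam yfam_uinv yfam_in_ID uinv_in_Mns)
  \<comment> \<open>By injectivity the preimage chosen by \<open>inv_into\<close> is the one given
    by \<open>uinv\<close>.\<close>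
  moreover have "inv_into (Mns n p s) (yfam n p s) z = uinv n p s z" if "z \<in> ID n p s" for z :: "(nat \<Rightarrow> nat) \<Rightarrow> 'a dop"
    using bij that by (intro inv_into_f_eq) (auto simp: bij_betw_def yfam_uinv uinv_in_Mns)
  ultimately show ?thesis by blast
qed

end
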